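(* Let $T$ be a positive theory and $C$ any (small) parameter set. Given any tree $(a_\eta)_{\eta\in\omega^{<\omega}}$ that is str-indiscernible over $C$, there is a tree $(b_\eta)_{\eta\in\omega^{<\omega}}$ that is $\mathrm{str}_0$-indiscernible over $C$ and $\mathrm{str}_0$-based on $(a_\eta)_{\eta\in\omega^{<\omega}}$ over $C$.
   Context: Work in a monster model (existentially closed, very homogeneous, very saturated) of a positive theory $T$; formulas are positive (built from atomic formulas by $\wedge,\vee,\top,\bot,\exists$), and $a\equiv_C b$ means equal positive types over $C$. Trees: on $\omega^{<\omega}$ (finite sequences of naturals), $\eta\unlhd\nu$ iff $\nu$ extends $\eta$; $\eta\wedge\nu$ is the longest common initial segment; $\eta<_{\mathrm{lex}}\nu$ iff $\eta\lhd\nu$, or they are incomparable and $\eta(\gamma)<\nu(\gamma)$ at the least differing $\gamma$; $\eta<_{\mathrm{len}}\nu$ iff $\eta$ is shorter than $\nu$. Languages: $\mathcal{L}_{\mathrm{str}}=\{\unlhd,\wedge,<_{\mathrm{lex}},<_{\mathrm{len}}\}$ and $\mathcal{L}_{\mathrm{str}_0}=\{\unlhd,\wedge,<_{\mathrm{lex}}\}$. For finite tuples $\bar\eta=(\eta_1,\dots,\eta_n)$, $a_{\bar\eta}=(a_{\eta_1},\dots,a_{\eta_n})$, and $\bar\eta\equiv^{\mathrm{str\text{-}qf}}\bar\nu$ (resp. $\equiv^{\mathrm{str}_0\text{-}\mathrm{qf}}$) means equal quantifier-free $\mathcal{L}_{\mathrm{str}}$-type (resp. $\mathcal{L}_{\mathrm{str}_0}$-type),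 full first-order sense. A tree is str-indiscernible (resp. $\mathrm{str}_0$-indiscernible) over $C$ if $\bar\eta\equiv^{\mathrm{str\text{-}qf}}\bar\nu$ (resp. $\equiv^{\mathrm{str}_0\text{-}\mathrm{qf}}$) implies $a_{\bar\eta}\equiv_C a_{\bar\nu}$. $(b_\eta)$ is $\mathrm{str}_0$-based on $(a_\eta)$ over $C$ if for every finite tuple $\bar\eta$ in $\omega^{<\omega}$ there is $\bar\nu$ in $\omega^{<\omega}$ with $\bar\nu\equiv^{\mathrm{str}_0\text{-}\mathrm{qf}}\bar\eta$ and $b_{\bar\eta}\equiv_C a_{\bar\nu}$. *)

theory Defs
  imports Main "HOL-Library.Sublist"
begin

section \<open>First-order syntax and semantics\<close>

text \<open>A symbol of a signature is a name together with an arity.\<close>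

record ('f, 'r) signature =
  funs :: "('f \<times> nat) set"
  rels :: "('r \<times> nat) set"

datatype 'f tm = Var nat | Fun 'f "'f tm list"

datatype ('f, 'r) fm =
    Eq "'f tm" "'f tm"
  | Rel 'r "'f tm list"
  | Top
  | Bot
  | Neg "('f, 'r) fm"
  | Conj "('f, 'r) fm" "('f, 'r) fm"
  | Disj "('f, 'r) fm" "('f, 'r) fm"
  | Ex nat "('f, 'r) fm"

fun wf_tm :: "('f, 'r) signature \<Rightarrow> 'f tm \<Rightarrow> bool" where
  "wf_tm L (Var i) \<longleftrightarrow> True"
| "wf_tm L (Fun f ts) \<longleftrightarrow> (f, length ts) \<in> funs L \<and> (\<forall>t \<in> set ts. wf_tm L t)"

primrec wf_fm :: "('f, 'r) signature \<Rightarrow> ('f, 'r) fm \<Rightarrow> bool" where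
  "wf_fm L (Eq s t) \<longleftrightarrow> wf_tm L s \<and> wf_tm L t"
| "wf_fm L (Rel r ts) \<longleftrightarrow> (r, length ts) \<in> rels L \<and> (\<forall>t \<in> set ts. wf_tm L t)"
| "wf_fm L Top \<longleftrightarrow> True"
| "wf_fm L Bot \<longleftrightarrow> True"
| "wf_fm L (Neg \<phi>) \<longleftrightarrow> wf_fm L \<phi>"
| "wf_fm L (Conj \<phi> \<psi>) \<longleftrightarrow> wf_fm L \<phi> \<and> wf_fm L \<psi>"
| "wf_fm L (Disj \<phi> \<psi>) \<longleftrightarrow> wf_fm L \<phi> \<and> wf_fm L \<psi>"
| "wf_fm L (Ex i \<phi>) \<longleftrightarrow> wf_fm L \<phi>"

fun fv_tm :: "'f tm \<Rightarrow> nat set" where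
  "fv_tm (Var i) = {i}"
| "fv_tm (Fun f ts) = \<Union> (fv_tm ` set ts)"

primrec fv :: "('f, 'r) fm \<Rightarrow> nat set" where
  "fv (Eq s t) = fv_tm s \<union> fv_tm t"
| "fv (Rel r ts) = \<Union> (fv_tm ` set ts)"
| "fv Top = {}"
| "fv Bot = {}"
| "fv (Neg \<phi>) = fv \<phi>"
| "fv (Conj \<phi> \<psi>) = fv \<phi> \<union> fv \<psi>"
| "fv (Disj \<phi> \<psi>) = fv \<phi> \<union> fv \<psi>"
| "fv (Ex i \<phi>) = fv \<phi> - {i}"

text \<open>Positive means positive existential: no negation (and there is no universal quantifier).\<close>

primrec positive :: "('f, 'r) fm \<Rightarrow> bool" where
  "positive (Eq s t) \<longleftrightarrow> True"
| "positive (Rel r ts) \<longleftrightarrow> True"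
| "positive Top \<longleftrightarrow> True"
| "positive Bot \<longleftrightarrow> True"
| "positive (Neg \<phi>) \<longleftrightarrow> False"
| "positive (Conj \<phi> \<psi>) \<longleftrightarrow> positive \<phi> \<and> positive \<psi>"
| "positive (Disj \<phi> \<psi>) \<longleftrightarrow> positive \<phi> \<and> positive \<psi>"
| "positive (Ex i \<phi>) \<longleftrightarrow> positive \<phi>"

primrec quantifier_free :: "('f, 'r) fm \<Rightarrow> bool" where
  "quantifier_free (Eq s t) \<longleftrightarrow> True"
| "quantifier_free (Rel r ts) \<longleftrightarrow> True"
| "quantifier_free Top \<longleftrightarrow> True"
| "quantifier_free Bot \<longleftrightarrow> True"
| "quantifier_free (Neg \<phi>) \<longleftrightarrow> quantifier_free \<phi>"
| "quantifier_free (Conj \<phi> \<psi>) \<longleftrightarrow> quantifier_free \<phi> \<and> quantifier_free \<psi>"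
| "quantifier_free (Disj \<phi> \<psi>) \<longleftrightarrow> quantifier_free \<phi> \<and> quantifier_free \<psi>"
| "quantifier_free (Ex i \<phi>) \<longleftrightarrow> False"

record ('f, 'r, 'a) struct =
  univ :: "'a set"
  fun_int :: "'f \<Rightarrow> 'a list \<Rightarrow> 'a"
  rel_int :: "'r \<Rightarrow> 'a list \<Rightarrow> bool"

definition structure_for :: "('f, 'r) signature \<Rightarrow> ('f, 'r, 'a) struct \<Rightarrow> bool" where
  "structure_for L M \<longleftrightarrow> univ M \<noteq> {} \<and>
     (\<forall>(f, n) \<in> funs L. \<forall>xs. length xs = n \<and> set xs \<subseteq> univ M \<longrightarrow> fun_int M f xs \<in> univ M)"

primrec val :: "('f, 'r, 'a) struct \<Rightarrow> (nat \<Rightarrow> 'a) \<Rightarrow> 'f tm \<Rightarrow> 'a" where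
  "val M v (Var i) = v i"
| "val M v (Fun f ts) = fun_int M f (map (val M v) ts)"

primrec sat :: "('f, 'r, 'a) struct \<Rightarrow> (nat \<Rightarrow> 'a) \<Rightarrow> ('f, 'r) fm \<Rightarrow> bool" where
  "sat M v (Eq s t) \<longleftrightarrow> val M v s = val M v t"
| "sat M v (Rel r ts) \<longleftrightarrow> rel_int M r (map (val M v) ts)"
| "sat M v Top \<longleftrightarrow> True"
| "sat M v Bot \<longleftrightarrow> False"
| "sat M v (Neg \<phi>) \<longleftrightarrow> \<not> sat M v \<phi>"
| "sat M v (Conj \<phi> \<psi>) \<longleftrightarrow> sat M v \<phi> \<and> sat M v \<psi>"
| "sat M v (Disj \<phi> \<psi>) \<longleftrightarrow> sat M v \<phi> \<or> sat M v \<psi>"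
| "sat M v (Ex i \<phi>) \<longleftrightarrow> (\<exists>x \<in> univ M. sat M (v(i := x)) \<phi>)"

definition positive_formula :: "('f, 'r) signature \<Rightarrow> ('f, 'r) fm \<Rightarrow> bool" where
  "positive_formula L \<phi> \<longleftrightarrow> wf_fm L \<phi> \<and> positive \<phi>"

section \<open>Positive theories and existentially closed models\<close>

text \<open>A pair \<open>(\<phi>, \<psi>)\<close> stands for the h-inductive sentence \<open>\<forall>x. \<phi>(x) \<longrightarrow> \<psi>(x)\<close>,
  where \<open>x\<close> lists all free variables of the two formulas.\<close>

type_synonym ('f, 'r) positive_theory = "(('f, 'r) fm \<times> ('f, 'r) fm) set"

definition positive_theory :: "('f, 'r) signature \<Rightarrow> ('f, 'r) positive_theory \<Rightarrow> bool" where
  "positive_theory L T \<longleftrightarrow> (\<forall>(\<phi>, \<psi>) \<in> T. positive_formula L \<phi> \<and> positive_formula L \<psi>)"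

definition model_of ::
    "('f, 'r) signature \<Rightarrow> ('f, 'r) positive_theory \<Rightarrow> ('f, 'r, 'a) struct \<Rightarrow> bool" where
  "model_of L T M \<longleftrightarrow> structure_for L M \<and>
     (\<forall>(\<phi>, \<psi>) \<in> T. \<forall>v. range v \<subseteq> univ M \<longrightarrow> sat M v \<phi> \<longrightarrow> sat M v \<psi>)"

definition homomorphism :: "('f, 'r) signature \<Rightarrow>
    ('f, 'r, 'a) struct \<Rightarrow> ('f, 'r, 'b) struct \<Rightarrow> ('a \<Rightarrow> 'b) \<Rightarrow> bool" where
  "homomorphism L M N h \<longleftrightarrow> h ` univ M \<subseteq> univ N \<and>
     (\<forall>(f, n) \<in> funs L. \<forall>xs. length xs = n \<and> set xs \<subseteq> univ M \<longrightarrow>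
        h (fun_int M f xs) = fun_int N f (map h xs)) \<and>
     (\<forall>(r, n) \<in> rels L. \<forall>xs. length xs = n \<and> set xs \<subseteq> univ M \<longrightarrow>
        rel_int M r xs \<longrightarrow> rel_int N r (map h xs))"

definition automorphism ::
    "('f, 'r) signature \<Rightarrow> ('f, 'r, 'a) struct \<Rightarrow> ('a \<Rightarrow> 'a) \<Rightarrow> bool" where
  "automorphism L M g \<longleftrightarrow> bij_betw g (univ M) (univ M) \<and>
     homomorphism L M M g \<and> homomorphism L M M (inv_into (univ M) g)"

text \<open>Existentially closed: homomorphisms into models of \<open>T\<close> reflect positive formulas.
  HOL cannot quantify over models \<open>N\<close> on all types, so \<open>N\<close> ranges over all models whose universe
  is a subset of one fixed type.  This is no restriction: the type is infinite
  and has at least as many elements as \<open>univ M\<close>, \<open>funs L\<close> and \<open>rels L\<close>, so by downward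
  Loewenheim-Skolem any homomorphism from \<open>M\<close> into a model of \<open>T\<close> corestricts to an elementary
  submodel which has an isomorphic copy with universe in that type.\<close>

definition existentially_closed ::
    "('f, 'r) signature \<Rightarrow> ('f, 'r) positive_theory \<Rightarrow> ('f, 'r, 'a) struct \<Rightarrow> bool" where
  "existentially_closed L T M \<longleftrightarrow> model_of L T M \<and>
     (\<forall>(N :: ('f, 'r, 'a + 'f + 'r + nat) struct) h.
        model_of L T N \<and> homomorphism L M N h \<longrightarrow>
          (\<forall>\<phi> v. positive_formula L \<phi> \<and> range v \<subseteq> univ M \<longrightarrow> sat N (h \<circ> v) \<phi> \<longrightarrow> sat M v \<phi>))"

section \<open>Formulas with parameters, types, monster models\<close>

text \<open>A formula with parameters is a pair \<open>(\<phi>, p)\<close>: the variables \<open>i\<close> with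
  \<open>p i = Some c\<close> are replaced by the parameter \<open>c\<close>, the others remain variables.\<close>

definition formulas_over ::
    "('f, 'r) signature \<Rightarrow> 'a set \<Rightarrow> (('f, 'r) fm \<times> (nat \<rightharpoonup> 'a)) set" where
  "formulas_over L C = {(\<phi>, p). positive_formula L \<phi> \<and> ran p \<subseteq> C}"

definition sat_param ::
    "('f, 'r, 'a) struct \<Rightarrow> (nat \<Rightarrow> 'a) \<Rightarrow> ('f, 'r) fm \<times> (nat \<rightharpoonup> 'a) \<Rightarrow> bool" where
  "sat_param M v = (\<lambda>(\<phi>, p). sat M (\<lambda>i. case p i of None \<Rightarrow> v i | Some c \<Rightarrow> c) \<phi>)"

text \<open>Equality of positive types over \<open>C\<close> of finite tuples; the formulas considered have their
  free variables among \<open>0, \<dots>, length xs - 1\<close>, and variable \<open>i\<close> is evaluated at \<open>xs ! i\<close>.\<close>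

definition same_type :: "('f, 'r) signature \<Rightarrow> ('f, 'r, 'a) struct \<Rightarrow> 'a set \<Rightarrow>
    'a list \<Rightarrow> 'a list \<Rightarrow> bool" where
  "same_type L M C xs ys \<longleftrightarrow> length xs = length ys \<and>
     (\<forall>(\<phi>, p) \<in> formulas_over L C. fv \<phi> - dom p \<subseteq> {..<length xs} \<longrightarrow>
        (sat_param M (nth xs) (\<phi>, p) \<longleftrightarrow> sat_param M (nth ys) (\<phi>, p)))"

definition partial_immersion :: "('f, 'r) signature \<Rightarrow> ('f, 'r, 'a) struct \<Rightarrow>
    'a set \<Rightarrow> ('a \<Rightarrow> 'a) \<Rightarrow> bool" where
  "partial_immersion L M A f \<longleftrightarrow> A \<subseteq> univ M \<and> f ` A \<subseteq> univ M \<and>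
     (\<forall>\<phi> v. positive_formula L \<phi> \<and> v ` fv \<phi> \<subseteq> A \<longrightarrow> (sat M v \<phi> \<longleftrightarrow> sat M (f \<circ> v) \<phi>))"

abbreviation small :: "'k rel \<Rightarrow> 'x set \<Rightarrow> bool" where
  "small \<kappa> X \<equiv> (card_of X, \<kappa>) \<in> ordLess"

definition very_homogeneous ::
    "('f, 'r) signature \<Rightarrow> 'k rel \<Rightarrow> ('f, 'r, 'a) struct \<Rightarrow> bool" where
  "very_homogeneous L \<kappa> M \<longleftrightarrow>
     (\<forall>A f. small \<kappa> A \<and> partial_immersion L M A f \<longrightarrow>
        (\<exists>g. automorphism L M g \<and> (\<forall>x \<in> A. g x = f x)))"

text \<open>A set of formulas may use all variables of the language, so saturation is for
  countable tuples; this is equivalent to realising types in one variable, or in any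
  small tuple of variables, since positive formulas are closed under conjunction and \<open>\<exists>\<close>.\<close>

definition very_saturated ::
    "('f, 'r) signature \<Rightarrow> 'k rel \<Rightarrow> ('f, 'r, 'a) struct \<Rightarrow> bool" where
  "very_saturated L \<kappa> M \<longleftrightarrow>
     (\<forall>\<Sigma>. \<Sigma> \<subseteq> formulas_over L (univ M) \<and> small \<kappa> \<Sigma> \<and>
          (\<forall>F. finite F \<and> F \<subseteq> \<Sigma> \<longrightarrow> (\<exists>v. range v \<subseteq> univ M \<and> (\<forall>\<sigma> \<in> F. sat_param M v \<sigma>)))
        \<longrightarrow> (\<exists>v. range v \<subseteq> univ M \<and> (\<forall>\<sigma> \<in> \<Sigma>. sat_param M v \<sigma>)))"

text \<open>\<open>\<kappa>\<close> is the cardinal bounding smallness: an uncountable cardinal bigger than the signature.\<close>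

definition monster_model :: "('f, 'r) signature \<Rightarrow> ('f, 'r) positive_theory \<Rightarrow> 'k rel \<Rightarrow>
    ('f, 'r, 'a) struct \<Rightarrow> bool" where
  "monster_model L T \<kappa> M \<longleftrightarrow>
     Card_order \<kappa> \<and> small \<kappa> (UNIV :: nat set) \<and> small \<kappa> (funs L) \<and> small \<kappa> (rels L) \<and>
     existentially_closed L T M \<and> very_homogeneous L \<kappa> M \<and> very_saturated L \<kappa> M"

section \<open>The tree of finite sequences of naturals\<close>

definition tree_lex :: "nat list \<Rightarrow> nat list \<Rightarrow> bool" where
  "tree_lex \<eta> \<nu> \<longleftrightarrow> strict_prefix \<eta> \<nu> \<or>
     (parallel \<eta> \<nu> \<and> (let \<gamma> = (LEAST \<gamma>. \<eta> ! \<gamma> \<noteq> \<nu> ! \<gamma>) in \<eta> ! \<gamma> < \<nu> ! \<gamma>))"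

datatype tree_fun = Meet
datatype tree_rel = Initial | Lex | Len

definition tree :: "(tree_fun, tree_rel, nat list) struct" where
  "tree = \<lparr> univ = UNIV,
     fun_int = (\<lambda>Meet \<Rightarrow> (\<lambda>xs. longest_common_prefix (xs ! 0) (xs ! 1))),
     rel_int = (\<lambda>r xs. case r of
        Initial \<Rightarrow> prefix (xs ! 0) (xs ! 1)
      | Lex \<Rightarrow> tree_lex (xs ! 0) (xs ! 1)
      | Len \<Rightarrow> length (xs ! 0) < length (xs ! 1)) \<rparr>"

definition L_str :: "(tree_fun, tree_rel) signature" where
  "L_str = \<lparr> funs = {(Meet, 2)}, rels = {(Initial, 2), (Lex, 2), (Len, 2)} \<rparr>"

definition L_str0 :: "(tree_fun, tree_rel) signature" where
  "L_str0 = \<lparr> funs = {(Meet, 2)}, rels = {(Initial, 2), (Lex, 2)} \<rparr>"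

text \<open>Equality of quantifier-free (full first-order) types in the tree.\<close>

definition tree_equiv ::
    "(tree_fun, tree_rel) signature \<Rightarrow> nat list list \<Rightarrow> nat list list \<Rightarrow> bool" where
  "tree_equiv S \<eta>s \<nu>s \<longleftrightarrow> length \<eta>s = length \<nu>s \<and>
     (\<forall>\<phi>. wf_fm S \<phi> \<and> quantifier_free \<phi> \<and> fv \<phi> \<subseteq> {..<length \<eta>s} \<longrightarrow>
        (sat tree (nth \<eta>s) \<phi> \<longleftrightarrow> sat tree (nth \<nu>s) \<phi>))"

definition tree_indiscernible :: "(tree_fun, tree_rel) signature \<Rightarrow> ('f, 'r) signature \<Rightarrow>
    ('f, 'r, 'a) struct \<Rightarrow> 'a set \<Rightarrow> (nat list \<Rightarrow> 'a) \<Rightarrow> bool" where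
  "tree_indiscernible S L M C a \<longleftrightarrow>
     (\<forall>\<eta>s \<nu>s. tree_equiv S \<eta>s \<nu>s \<longrightarrow> same_type L M C (map a \<eta>s) (map a \<nu>s))"

definition tree_based :: "(tree_fun, tree_rel) signature \<Rightarrow> ('f, 'r) signature \<Rightarrow>
    ('f, 'r, 'a) struct \<Rightarrow> 'a set \<Rightarrow> (nat list \<Rightarrow> 'a) \<Rightarrow> (nat list \<Rightarrow> 'a) \<Rightarrow> bool" where
  "tree_based S L M C b a \<longleftrightarrow>
     (\<forall>\<eta>s. \<exists>\<nu>s. tree_equiv S \<nu>s \<eta>s \<and> same_type L M C (map b \<eta>s) (map a \<nu>s))"

end

theory Submission
  imports Defs "HOL-Library.Countable"
begin

text \<open>Fix \<open>n\<close> and embed the tree of sequences of length at most \<open>n\<close> with entries below \<open>n\<close> into the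
  full tree, preserving meets and the lexicographic order, in such a way that the levels of the images
  are ordered exactly like the sequences themselves are ordered lexicographically.  The length order
  then carries no additional information on the images, so that \<open>str\<^sub>0\<close>-equivalent tuples have
  \<open>str\<close>-equivalent images.  Hence the tree pulled back along such an embedding is
  \<open>str\<^sub>0\<close>-indiscernible, and its types do not depend on \<open>n\<close>.  Saturation realises the limit of these
  types for \<open>n \<rightarrow> \<infinity>\<close>; no single embedding of the full tree would do, as its lexicographic order has
  infinite descending chains.

  Saturation only yields a tuple satisfying at least the given positive formulas.  That it satisfies
  no others is the maximality of positive types in an existentially closed model \<open>M\<close>: if
  every positive formula true of \<open>x\<close> holds of \<open>y\<close>, there is a homomorphism from \<open>M\<close> to an ultrapower
  of \<open>M\<close> sending \<open>x\<close> to the diagonal image of \<open>y\<close>, and homomorphisms to models of \<open>T\<close> reflect positive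
  formulas.  As existential closedness only concerns models on a fixed type, the
  ultrapower is cut down to a Skolem hull.\<close>

section \<open>Linearising the levels of the tree\<close>

lemma tree_lex_Nil [simp]:
  "tree_lex [] \<nu> \<longleftrightarrow> \<nu> \<noteq> []" "tree_lex (x # \<eta>) [] \<longleftrightarrow> False"
  by (auto simp: tree_lex_def strict_prefix_def parallel_def)

lemma Least_differing_index_Cons:
  assumes "parallel \<eta> \<nu>"
  shows "(LEAST i. (x # \<eta>) ! i \<noteq> (x # \<nu>) ! i) = Suc (LEAST i. \<eta> ! i \<noteq> \<nu> ! i)"
proof -
  from assms obtain ps y z ys zs
    where "y \<noteq> z" "\<eta> = ps @ y # ys" "\<nu> = ps @ z # zs"
    using parallel_decomp by blast
  then have "\<eta> ! length ps \<noteq> \<nu> ! length ps" by simp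
  then have "(x # \<eta>) ! Suc (length ps) \<noteq> (x # \<nu>) ! Suc (length ps)" by simp
  then have "(LEAST i. (x # \<eta>) ! i \<noteq> (x # \<nu>) ! i)
      = Suc (LEAST i. (x # \<eta>) ! Suc i \<noteq> (x # \<nu>) ! Suc i)"
    by (rule Least_Suc) simp
  then show ?thesis by simp
qed

text \<open>Replaces the least differing index by a recursion on the heads, the form in which the
  later inductions use the order.\<close>

lemma tree_lex_Cons [simp]:
  "tree_lex (x # \<eta>) (y # \<nu>) \<longleftrightarrow> x < y \<or> x = y \<and> tree_lex \<eta> \<nu>"
proof (cases "x = y")
  case True
  then show ?thesis
    by (auto simp: tree_lex_def Let_def Least_differing_index_Cons strict_prefix_def parallel_def)
next
  case False
  then have "(LEAST i. (x # \<eta>) ! i \<noteq> (y # \<nu>) ! i) = 0"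
    by (intro Least_eq_0) simp
  with False show ?thesis
    by (auto simp: tree_lex_def Let_def strict_prefix_def parallel_def)
qed

lemma tree_lex_linear: "tree_lex \<eta> \<nu> \<or> \<eta> = \<nu> \<or> tree_lex \<nu> \<eta>"
proof (induction \<eta> arbitrary: \<nu>)
  case Nil
  then show ?case by auto
next
  case (Cons x \<eta>)
  then show ?case by (cases \<nu>) auto
qed

lemma tree_lex_irrefl: "\<not> tree_lex \<eta> \<eta>"
  by (induction \<eta>) auto

lemma tree_lex_asym: "tree_lex \<eta> \<nu> \<Longrightarrow> \<not> tree_lex \<nu> \<eta>"
  by (induction \<eta> \<nu> rule: longest_common_prefix.induct) (auto simp: neq_Nil_conv)

text \<open>Reduces prefixes to meets, so that an injective map preserving meets preserves and
  reflects prefixes.\<close>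

lemma prefix_iff_meet_eq: "prefix \<eta> \<nu> \<longleftrightarrow> longest_common_prefix \<eta> \<nu> = \<eta>"
  by (metis longest_common_prefix_max_prefix longest_common_prefix_prefix1
      longest_common_prefix_prefix2 prefix_order.antisym prefix_order.refl)

text \<open>Each entry \<open>x\<close> at depth \<open>i\<close> is padded with zeros to a block of length \<open>(x + 1) * B ^ (m - 1 - i)\<close>:
  the length of the image is then a base-\<open>B\<close> number whose digits are the entries plus one,
  and comparing such numbers amounts to comparing the sequences lexicographically.\<close>

fun lex_level :: "nat \<Rightarrow> nat \<Rightarrow> nat list \<Rightarrow> nat list" where
  "lex_level B (Suc m) (x # \<eta>) = x # replicate ((x + 1) * B ^ m - 1) 0 @ lex_level B m \<eta>"
| "lex_level B _ _ = []"

text \<open>The condition \<open>x + 2 \<le> B\<close> makes \<open>x + 1\<close> a proper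
  base-\<open>B\<close> digit.\<close>

definition bounded_tree :: "nat \<Rightarrow> nat \<Rightarrow> nat list set" where
  "bounded_tree B m = {\<eta>. length \<eta> \<le> m \<and> (\<forall>x \<in> set \<eta>. x + 2 \<le> B)}"

lemma Cons_in_bounded_tree:
  "x # \<eta> \<in> bounded_tree B m \<longleftrightarrow> (\<exists>k. m = Suc k \<and> \<eta> \<in> bounded_tree B k) \<and> x + 2 \<le> B"
  by (cases m) (auto simp: bounded_tree_def)

lemma bounded_tree_meet:
  "\<eta> \<in> bounded_tree B m \<Longrightarrow> longest_common_prefix \<eta> \<nu> \<in> bounded_tree B m"
  using longest_common_prefix_prefix1[of \<eta> \<nu>]
  by (auto simp: bounded_tree_def dest: prefix_length_le set_mono_prefix)

lemma length_lex_level_Cons: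
  assumes "B > 0"
  shows "length (lex_level B (Suc m) (x # \<eta>)) = (x + 1) * B ^ m + length (lex_level B m \<eta>)"
proof -
  \<comment> \<open>Positivity makes the truncated \<open>- 1\<close> exact; it accounts for the
    entry \<open>x\<close> itself, which opens the block.\<close>
  have "(x + 1) * B ^ m > 0" using assms by simp
  then show ?thesis by (simp del: add_Suc mult_Suc)
qed

text \<open>The leading digit is at most \<open>B - 1\<close>, so a remainder below
  \<open>B ^ k\<close> cannot carry past \<open>B ^ Suc k\<close>.\<close>

lemma length_lex_level_less:
  assumes "\<eta> \<in> bounded_tree B m" "B > 0"
  shows "length (lex_level B m \<eta>) < B ^ m"
  using assms
proof (induction \<eta> arbitrary: m)
  case (Cons x \<eta>)
  then obtain k where k: "m = Suc k" "\<eta> \<in> bounded_tree B k" "x + 2 \<le> B"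
    by (auto simp: Cons_in_bounded_tree)
  have "length (lex_level B m (x # \<eta>)) < (x + 1) * B ^ k + B ^ k"
    using Cons.IH[OF k(2) Cons.prems(2)] length_lex_level_Cons[OF Cons.prems(2)] k(1) by simp
  also have "\<dots> = (x + 2) * B ^ k" by (simp add: algebra_simps)
  also have "\<dots> \<le> B ^ m" using k(1) mult_le_mono1[OF k(3)] by simp
  finally show ?case .
qed simp

text \<open>At the first difference the larger digit gains at least \<open>B ^ k\<close>, more than
  the later digits of \<open>\<eta>\<close> can contribute.\<close>

lemma lex_level_length_mono:
  assumes "\<eta> \<in> bounded_tree B m" "\<nu> \<in> bounded_tree B m" "B > 0" "tree_lex \<eta> \<nu>"
  shows "length (lex_level B m \<eta>) < length (lex_level B m \<nu>)"
  using assms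
proof (induction \<eta> arbitrary: \<nu> m)
  case Nil
  then obtain y \<nu>' k where "\<nu> = y # \<nu>'" "m = Suc k"
    by (auto simp: neq_Nil_conv Cons_in_bounded_tree)
  then show ?case by simp
next
  case (Cons x \<eta>)
  then obtain y \<nu>' k where y: "\<nu> = y # \<nu>'" "m = Suc k"
      "\<eta> \<in> bounded_tree B k" "\<nu>' \<in> bounded_tree B k"
    by (cases \<nu>) (auto simp: Cons_in_bounded_tree)
  from Cons.prems(4) y(1) consider "x < y" | "x = y" "tree_lex \<eta> \<nu>'" by auto
  then show ?case
  proof cases
    case 1
    have "length (lex_level B m (x # \<eta>)) < (x + 1) * B ^ k + B ^ k"
      using length_lex_level_less[OF y(3) Cons.prems(3)] length_lex_level_Cons[OF Cons.prems(3)] y(2)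
      by simp
    also have "\<dots> = (x + 2) * B ^ k" by (simp add: algebra_simps)
    also have "\<dots> \<le> (y + 1) * B ^ k" using 1 by (intro mult_le_mono1) simp
    also have "\<dots> \<le> length (lex_level B m \<nu>)"
      using length_lex_level_Cons[OF Cons.prems(3)] y(1,2) by simp
    finally show ?thesis .
  next
    case 2
    with Cons.IH[OF y(3,4) Cons.prems(3)] y(1,2) show ?thesis by simp
  qed
qed

lemma longest_common_prefix_append:
  "longest_common_prefix (xs @ ys) (xs @ zs) = xs @ longest_common_prefix ys zs"
  by (induction xs) auto

lemma tree_lex_append: "tree_lex (xs @ ys) (xs @ zs) \<longleftrightarrow> tree_lex ys zs"
  by (induction xs) auto

text \<open>Equal entries produce equal blocks, and distinct entries separate the images at once
  because each block begins with its entry.\<close>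

lemma lex_level_meet:
  "lex_level B m (longest_common_prefix \<eta> \<nu>)
    = longest_common_prefix (lex_level B m \<eta>) (lex_level B m \<nu>)"
proof (induction \<eta> \<nu> arbitrary: m rule: longest_common_prefix.induct)
  case (1 x xs y ys)
  then show ?case by (cases m) (auto simp: longest_common_prefix_append)
next
  case ("2_1" v)
  then show ?case by (cases m) auto
next
  case ("2_2" v)
  then show ?case by (cases m; cases v) auto
qed

lemma lex_level_lex_mono:
  assumes "\<eta> \<in> bounded_tree B m" "\<nu> \<in> bounded_tree B m" "tree_lex \<eta> \<nu>"
  shows "tree_lex (lex_level B m \<eta>) (lex_level B m \<nu>)"
  using assms
proof (induction \<eta> arbitrary: \<nu> m)
  case Nil
  then show ?case by (cases \<nu>) (auto simp: Cons_in_bounded_tree)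
next
  case (Cons x \<eta>)
  then show ?case
    by (cases \<nu>) (auto simp: Cons_in_bounded_tree tree_lex_append)
qed

lemma tree_simps [simp]:
  "fun_int tree Meet [\<eta>, \<nu>] = longest_common_prefix \<eta> \<nu>"
  "rel_int tree Initial [\<eta>, \<nu>] \<longleftrightarrow> prefix \<eta> \<nu>"
  "rel_int tree Lex [\<eta>, \<nu>] \<longleftrightarrow> tree_lex \<eta> \<nu>"
  "rel_int tree Len [\<eta>, \<nu>] \<longleftrightarrow> length \<eta> < length \<nu>"
  by (simp_all add: tree_def)

text \<open>Replacing the level order by the lexicographic order turns quantifier-free facts about the
  images under \<open>lex_level\<close> into facts about the original sequences.\<close>

primrec len_to_lex :: "(tree_fun, tree_rel) fm \<Rightarrow> (tree_fun, tree_rel) fm" where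
  "len_to_lex (Eq s t) = Eq s t"
| "len_to_lex (Rel r ts) = Rel (if r = Len then Lex else r) ts"
| "len_to_lex Top = Top"
| "len_to_lex Bot = Bot"
| "len_to_lex (Neg \<phi>) = Neg (len_to_lex \<phi>)"
| "len_to_lex (Conj \<phi> \<psi>) = Conj (len_to_lex \<phi>) (len_to_lex \<psi>)"
| "len_to_lex (Disj \<phi> \<psi>) = Disj (len_to_lex \<phi>) (len_to_lex \<psi>)"
| "len_to_lex (Ex i \<phi>) = Ex i (len_to_lex \<phi>)"

lemma wf_tm_L_str0: "wf_tm L_str0 t \<longleftrightarrow> wf_tm L_str t"
  by (induction t) (auto simp: L_str0_def L_str_def)

lemma wf_fm_L_str0:
  "wf_fm L_str0 \<phi> \<Longrightarrow> wf_fm L_str \<phi>" "wf_fm L_str0 \<phi> \<Longrightarrow> len_to_lex \<phi> = \<phi>"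
  by (induction \<phi>) (auto simp: wf_tm_L_str0, auto simp: L_str0_def L_str_def)

lemma len_to_lex:
  "wf_fm L_str \<phi> \<Longrightarrow> wf_fm L_str0 (len_to_lex \<phi>)"
  "fv (len_to_lex \<phi>) = fv \<phi>"
  "quantifier_free \<phi> \<Longrightarrow> quantifier_free (len_to_lex \<phi>)"
  by (induction \<phi>) (auto simp: wf_tm_L_str0, auto simp: L_str0_def L_str_def)

context
  fixes B m :: nat
  assumes B: "B > 0"
begin

text \<open>A strictly increasing map on a linear order also reflects it.\<close>

lemma lex_level_lex_iff:
  assumes "\<eta> \<in> bounded_tree B m" "\<nu> \<in> bounded_tree B m"
  shows "tree_lex (lex_level B m \<eta>) (lex_level B m \<nu>) \<longleftrightarrow> tree_lex \<eta> \<nu>"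
  using assms lex_level_lex_mono tree_lex_linear tree_lex_asym tree_lex_irrefl by metis

lemma lex_level_length_iff:
  assumes "\<eta> \<in> bounded_tree B m" "\<nu> \<in> bounded_tree B m"
  shows "length (lex_level B m \<eta>) < length (lex_level B m \<nu>) \<longleftrightarrow> tree_lex \<eta> \<nu>"
  using assms lex_level_length_mono[OF _ _ B] tree_lex_linear by (metis less_asym less_irrefl)

lemma lex_level_inj:
  assumes "\<eta> \<in> bounded_tree B m" "\<nu> \<in> bounded_tree B m"
  shows "lex_level B m \<eta> = lex_level B m \<nu> \<longleftrightarrow> \<eta> = \<nu>"
  using assms lex_level_lex_iff tree_lex_linear tree_lex_irrefl by metis

lemma lex_level_prefix_iff:
  assumes "\<eta> \<in> bounded_tree B m" "\<nu> \<in> bounded_tree B m"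
  shows "prefix (lex_level B m \<eta>) (lex_level B m \<nu>) \<longleftrightarrow> prefix \<eta> \<nu>"
  using assms bounded_tree_meet by (simp add: prefix_iff_meet_eq lex_level_meet[symmetric] lex_level_inj)

lemma val_lex_level:
  assumes "wf_tm L_str t" "u ` fv_tm t \<subseteq> bounded_tree B m"
    "\<And>i. i \<in> fv_tm t \<Longrightarrow> v i = lex_level B m (u i)"
  shows "val tree u t \<in> bounded_tree B m \<and> val tree v t = lex_level B m (val tree u t)"
  using assms
proof (induction t)
  case (Fun f ts)
  from Fun.prems(1) obtain s t where ts: "ts = [s, t]" 
    by (auto simp: L_str_def numeral_2_eq_2 length_Suc_conv)
  have f: "f = Meet" by (cases f)
  have s: "val tree u s \<in> bounded_tree B m \<and> val tree v s = lex_level B m (val tree u s)"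
    by (rule Fun.IH) (use Fun.prems ts in auto)
  have t: "val tree u t \<in> bounded_tree B m \<and> val tree v t = lex_level B m (val tree u t)"
    by (rule Fun.IH) (use Fun.prems ts in auto)
  from s t show ?case
    by (simp add: ts f bounded_tree_meet lex_level_meet)
qed auto

text \<open>On images \<open>Len\<close> and \<open>Lex\<close> both mean \<open>Lex\<close> of the
  sources. Quantifiers are excluded because witnesses in the full tree may lie outside the
  image.\<close>

lemma sat_lex_level:
  assumes "wf_fm L_str \<phi>" "quantifier_free \<phi>" "u ` fv \<phi> \<subseteq> bounded_tree B m"
    "\<And>i. i \<in> fv \<phi> \<Longrightarrow> v i = lex_level B m (u i)"
  shows "sat tree v \<phi> \<longleftrightarrow> sat tree u (len_to_lex \<phi>)"
  using assms
proof (induction \<phi>)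
  case (Eq s t)
  have "val tree u s \<in> bounded_tree B m \<and> val tree v s = lex_level B m (val tree u s)"
    by (rule val_lex_level) (use Eq.prems in auto)
  moreover have "val tree u t \<in> bounded_tree B m \<and> val tree v t = lex_level B m (val tree u t)"
    by (rule val_lex_level) (use Eq.prems in auto)
  ultimately show ?case by (simp add: lex_level_inj)
next
  case (Rel r ts)
  from Rel.prems(1) obtain s t where ts: "ts = [s, t]" 
    by (auto simp: L_str_def numeral_2_eq_2 length_Suc_conv)
  have "val tree u s \<in> bounded_tree B m \<and> val tree v s = lex_level B m (val tree u s)"
    by (rule val_lex_level) (use Rel.prems ts in auto)
  moreover have "val tree u t \<in> bounded_tree B m \<and> val tree v t = lex_level B m (val tree u t)"
    by (rule val_lex_level) (use Rel.prems ts in auto)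
  ultimately show ?case
    by (cases r) (simp_all add: ts lex_level_lex_iff lex_level_length_iff lex_level_prefix_iff)
qed auto

end

text \<open>The translation reduces both image types to one \<open>L_str0\<close>-type. Separate
  parameters on the two sides allow images under different embeddings to be compared.\<close>

lemma tree_equiv_lex_level:
  assumes "B > 0" "set \<eta>s \<subseteq> bounded_tree B m" "B' > 0" "set \<nu>s \<subseteq> bounded_tree B' m'"
    and "tree_equiv L_str0 \<eta>s \<nu>s"
  shows "tree_equiv L_str (map (lex_level B m) \<eta>s) (map (lex_level B' m') \<nu>s)"
  unfolding tree_equiv_def
proof (intro conjI allI impI)
  have len: "length \<eta>s = length \<nu>s" using assms(5) by (simp add: tree_equiv_def)
  then show "length (map (lex_level B m) \<eta>s) = length (map (lex_level B' m') \<nu>s)" by simp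
  fix \<phi> assume \<phi>: "wf_fm L_str \<phi> \<and> quantifier_free \<phi> \<and> fv \<phi> \<subseteq> {..<length (map (lex_level B m) \<eta>s)}"
  have "sat tree (nth (map (lex_level B m) \<eta>s)) \<phi> \<longleftrightarrow> sat tree (nth \<eta>s) (len_to_lex \<phi>)"
    by (rule sat_lex_level[where m = m, OF assms(1)]) (use \<phi> assms(2) nth_mem in \<open>fastforce+\<close>)
  also have "\<dots> \<longleftrightarrow> sat tree (nth \<nu>s) (len_to_lex \<phi>)"
    using assms(5) \<phi> len_to_lex by (simp add: tree_equiv_def)
  also have "\<dots> \<longleftrightarrow> sat tree (nth (map (lex_level B' m') \<nu>s)) \<phi>"
    by (rule sat_lex_level[where m = m', OF assms(3), symmetric])
      (use \<phi> assms(4) len nth_mem in \<open>fastforce+\<close>)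
  finally show "sat tree (nth (map (lex_level B m) \<eta>s)) \<phi>
      \<longleftrightarrow> sat tree (nth (map (lex_level B' m') \<nu>s)) \<phi>" .
qed

text \<open>Formulas without \<open>Len\<close> are fixed by \<open>len_to_lex\<close>, so the
  embedding preserves them; this supplies the witnesses for \<open>tree_based\<close>.\<close>

lemma tree_equiv_str0_lex_level:
  assumes "B > 0" "set \<eta>s \<subseteq> bounded_tree B m"
  shows "tree_equiv L_str0 (map (lex_level B m) \<eta>s) \<eta>s"
  unfolding tree_equiv_def
proof (intro conjI allI impI)
  fix \<phi> assume \<phi>: "wf_fm L_str0 \<phi> \<and> quantifier_free \<phi> \<and> fv \<phi> \<subseteq> {..<length (map (lex_level B m) \<eta>s)}"
  have "sat tree (nth (map (lex_level B m) \<eta>s)) \<phi> \<longleftrightarrow> sat tree (nth \<eta>s) (len_to_lex \<phi>)"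
    by (rule sat_lex_level[where m = m, OF assms(1)])
      (use \<phi> wf_fm_L_str0 assms(2) nth_mem in \<open>fastforce+\<close>)
  with \<phi> show "sat tree (nth (map (lex_level B m) \<eta>s)) \<phi> \<longleftrightarrow> sat tree (nth \<eta>s) \<phi>"
    by (simp add: wf_fm_L_str0)
qed simp

section \<open>Cardinalities\<close>

unbundle cardinal_syntax

lemma card_of_nat_ordLeq: "infinite X \<Longrightarrow> |A :: nat set| \<le>o |X|"
  using ordLeq_transitive[OF card_of_mono1[OF subset_UNIV[of A]]] infinite_iff_card_of_nat by blast

lemma card_of_Times_ordLeq:
  "infinite X \<Longrightarrow> |A| \<le>o |X| \<Longrightarrow> |B| \<le>o |X| \<Longrightarrow> |A \<times> B| \<le>o |X|"
  by (rule card_of_Sigma_ordLeq_infinite) blast+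

lemma card_of_image_ordLeq: "|A| \<le>o |X| \<Longrightarrow> |f ` A| \<le>o |X|"
  using card_of_image ordLeq_transitive by blast

lemma card_of_Un_ordLeq:
  assumes "infinite X" "|A| \<le>o |X|" "|B| \<le>o |X|"
  shows "|A \<union> B| \<le>o |X|"
  using card_of_Un_ordLeq_infinite_Field[of "|X|" A B] assms
  by (simp add: Field_card_of card_of_card_order_on)

lemma card_of_lists_ordLeq:
  assumes X: "infinite X" and A: "|A| \<le>o |X|"
  shows "|lists A| \<le>o |X|"
proof -
  let ?L = "\<lambda>n. {xs \<in> lists A. length xs = n}"
  have "|?L n| \<le>o |X|" for n
  proof (induction n)
    case 0
    have "?L 0 = {[]}" by auto
    then show ?case using card_of_singl_ordLeq[of X "[]"] X by force
  next
    case (Suc n)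
    have "?L (Suc n) \<subseteq> (\<lambda>(x, xs). x # xs) ` (A \<times> ?L n)"
    proof
      fix xs assume "xs \<in> ?L (Suc n)"
      then obtain y ys where "xs = y # ys" "y \<in> A" "ys \<in> ?L n"
        by (cases xs) auto
      then show "xs \<in> (\<lambda>(x, xs). x # xs) ` (A \<times> ?L n)" by force
    qed
    moreover have "|(\<lambda>(x, xs). x # xs) ` (A \<times> ?L n)| \<le>o |X|"
      by (intro card_of_image_ordLeq card_of_Times_ordLeq X A Suc)
    ultimately show ?case by (rule ordLeq_transitive[OF card_of_mono1])
  qed
  then have "|\<Union>n. ?L n| \<le>o |X|"
    by (intro card_of_UNION_ordLeq_infinite X card_of_nat_ordLeq ballI)
  moreover have "(\<Union>n. ?L n) = lists A" by auto
  ultimately show ?thesis by simp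
qed

text \<open>Arities are left open by letting each operation act on all lists, so one closure serves
  for terms, formulas and Skolem hulls. Lists of unintended length are harmless for upper bounds on
  cardinality.\<close>

inductive_set hull :: "'b set \<Rightarrow> 'i set \<Rightarrow> ('i \<Rightarrow> 'b list \<Rightarrow> 'b) \<Rightarrow> 'b set" for S I F where
  hull_base: "x \<in> S \<Longrightarrow> x \<in> hull S I F"
| hull_step: "i \<in> I \<Longrightarrow> xs \<in> lists (hull S I F) \<Longrightarrow> F i xs \<in> hull S I F"

lemma card_of_hull_ordLeq:
  assumes X: "infinite X" and S: "|S| \<le>o |X|" and I: "|I| \<le>o |X|"
  shows "|hull S I F| \<le>o |X|"
proof -
  \<comment> \<open>\<open>H n\<close> is the result of \<open>n\<close> rounds of applying the
    operations. A finite list over the union already lies in one stage, so countably many rounds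
    suffice.\<close>
  define H where "H n = ((\<lambda>G. G \<union> (\<lambda>(i, xs). F i xs) ` (I \<times> lists G)) ^^ n) S" for n
  have H_Suc: "H (Suc n) = H n \<union> (\<lambda>(i, xs). F i xs) ` (I \<times> lists (H n))" for n
    by (simp add: H_def)
  have H_mono: "H m \<subseteq> H n" if "m \<le> n" for m n
    using that by (induction rule: dec_induct) (auto simp: H_Suc)
  have "|H n| \<le>o |X|" for n
  proof (induction n)
    case 0
    then show ?case using S by (simp add: H_def)
  next
    case (Suc n)
    then show ?case unfolding H_Suc
      by (intro card_of_Un_ordLeq card_of_image_ordLeq card_of_Times_ordLeq card_of_lists_ordLeq X I)
  qed
  then have card: "|\<Union>n. H n| \<le>o |X|"
    by (intro card_of_UNION_ordLeq_infinite X card_of_nat_ordLeq ballI)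
  have lists_H: "\<exists>n. xs \<in> lists (H n)" if "xs \<in> lists (\<Union>n. H n)" for xs
    using that
  proof (induction xs)
    case (Cons x xs)
    then obtain m n where "x \<in> H m" "xs \<in> lists (H n)" by auto
    with H_mono[of m "max m n"] H_mono[of n "max m n"] have "x # xs \<in> lists (H (max m n))"
      by auto
    then show ?case by blast
  qed simp
  have "x \<in> (\<Union>n. H n)" if "x \<in> hull S I F" for x
    using that
  proof induction
    case (hull_base x)
    then have "x \<in> H 0" by (simp add: H_def)
    then show ?case by blast
  next
    case (hull_step i xs)
    then have "xs \<in> lists (\<Union>n. H n)" by auto
    then obtain n where "xs \<in> lists (H n)" using lists_H by blast
    with hull_step(1) have "F i xs \<in> H (Suc n)" by (auto simp: H_Suc image_iff)
    then show ?case by blast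
  qed
  then have "hull S I F \<subseteq> (\<Union>n. H n)" by blast
  then show ?thesis using card by (rule ordLeq_transitive[OF card_of_mono1])
qed

section \<open>The number of terms and formulas over a signature\<close>

lemma card_of_wf_tm:
  assumes X: "infinite X" and f: "|funs L| \<le>o |X|"
  shows "|{t. wf_tm L t}| \<le>o |X|"
proof -
  have "t \<in> hull (range Var) (funs L) (\<lambda>(f, n). Fun f)" if "wf_tm L t" for t
    using that
  proof (induction t)
    case (Var i)
    then show ?case by (blast intro: hull_base)
  next
    case (Fun f ts)
    then show ?case
      using hull_step[of "(f, length ts)" "funs L" ts "range Var" "\<lambda>(f, n). Fun f"] by auto
  qed
  then have "{t. wf_tm L t} \<subseteq> hull (range Var) (funs L) (\<lambda>(f, n). Fun f)" by blast
  moreover have "|hull (range Var) (funs L) (\<lambda>(f, n). Fun f)| \<le>o |X|"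
    by (intro card_of_hull_ordLeq card_of_image_ordLeq card_of_nat_ordLeq X f)
  ultimately show ?thesis by (rule ordLeq_transitive[OF card_of_mono1])
qed

lemma card_of_wf_fm:
  fixes L :: "('f, 'r) signature"
  assumes X: "infinite X" and f: "|funs L| \<le>o |X|" and r: "|rels L| \<le>o |X|"
  shows "|{\<phi>. wf_fm L \<phi>}| \<le>o |X|"
proof -
  define W where "W = {t. wf_tm L t}"
  define S :: "('f, 'r) fm set" where "S = (\<lambda>(s, t). Eq s t) ` (W \<times> W)
    \<union> (\<lambda>((r, n), ts). Rel r ts) ` (rels L \<times> lists W) \<union> (\<lambda>n::nat. if n = 0 then Top else Bot) ` UNIV"
  \<comment> \<open>The indices 0, 1, 2 code negation, conjunction and disjunction; index
    \<open>i + 3\<close> codes the quantifier over variable \<open>i\<close>.\<close>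
  define F :: "nat \<Rightarrow> ('f, 'r) fm list \<Rightarrow> ('f, 'r) fm" where
    "F i \<phi>s = (if i = 0 then Neg (\<phi>s ! 0) else if i = 1 then Conj (\<phi>s ! 0) (\<phi>s ! 1)
      else if i = 2 then Disj (\<phi>s ! 0) (\<phi>s ! 1) else Ex (i - 3) (\<phi>s ! 0))" for i \<phi>s
  have F: "F 0 [\<phi>] = Neg \<phi>" "F 1 [\<phi>, \<psi>] = Conj \<phi> \<psi>" "F 2 [\<phi>, \<psi>] = Disj \<phi> \<psi>" "F (i + 3) [\<phi>] = Ex i \<phi>"
    for \<phi> \<psi> i by (simp_all add: F_def)
  have "\<phi> \<in> hull S UNIV F" if "wf_fm L \<phi>" for \<phi>
    using that
  proof (induction \<phi>)
    case (Eq s t)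
    then have "Eq s t \<in> S" by (auto simp: S_def W_def)
    then show ?case by (rule hull_base)
  next
    case (Rel r ts)
    then have "((r, length ts), ts) \<in> rels L \<times> lists W" by (auto simp: W_def)
    then have "Rel r ts \<in> S" unfolding S_def by (force simp: image_iff)
    then show ?case by (rule hull_base)
  next
    case Top
    have "Top \<in> S" unfolding S_def by (auto intro: image_eqI[of _ _ 0])
    then show ?case by (rule hull_base)
  next
    case Bot
    have "Bot \<in> S" unfolding S_def by (auto intro: image_eqI[of _ _ 1])
    then show ?case by (rule hull_base)
  next
    case (Neg \<phi>)
    then show ?case using hull_step[of 0 UNIV "[\<phi>]" S F] by (simp add: F del: One_nat_def)
  next
    case (Conj \<phi> \<psi>)
    then show ?case using hull_step[of 1 UNIV "[\<phi>, \<psi>]" S F] by (simp add: F del: One_nat_def)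
  next
    case (Disj \<phi> \<psi>)
    then show ?case using hull_step[of 2 UNIV "[\<phi>, \<psi>]" S F] by (simp add: F del: One_nat_def)
  next
    case (Ex i \<phi>)
    then show ?case using hull_step[of "i + 3" UNIV "[\<phi>]" S F] by (simp add: F del: One_nat_def)
  qed
  then have "{\<phi>. wf_fm L \<phi>} \<subseteq> hull S UNIV F" by blast
  moreover have "|hull S UNIV F| \<le>o |X|"
    unfolding S_def W_def
    by (intro card_of_hull_ordLeq card_of_Un_ordLeq card_of_image_ordLeq card_of_Times_ordLeq
        card_of_lists_ordLeq card_of_wf_tm card_of_nat_ordLeq X f r)
  ultimately show ?thesis by (rule ordLeq_transitive[OF card_of_mono1])
qed

section \<open>Skolem hulls of ultrapowers\<close>

lemma val_cong: "(\<And>i. i \<in> fv_tm t \<Longrightarrow> u i = v i) \<Longrightarrow> val M u t = val M v t"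
proof (induction t)
  case (Fun f ts)
  have "map (val M u) ts = map (val M v) ts"
    by (rule map_cong[OF refl], rule Fun.IH) (use Fun.prems in auto)
  then show ?case by (simp only: val.simps)
qed simp

lemma sat_cong: "(\<And>i. i \<in> fv \<phi> \<Longrightarrow> u i = v i) \<Longrightarrow> sat M u \<phi> \<longleftrightarrow> sat M v \<phi>"
proof (induction \<phi> arbitrary: u v)
  case (Eq s t)
  then show ?case using val_cong[of s u v M] val_cong[of t u v M] by simp
next
  case (Rel r ts)
  have "map (val M u) ts = map (val M v) ts"
    by (rule map_cong[OF refl], rule val_cong) (use Rel.prems in auto)
  then show ?case by (simp only: sat.simps)
next
  case (Neg \<phi>)
  have "sat M u \<phi> \<longleftrightarrow> sat M v \<phi>"
    by (rule Neg.IH) (use Neg.prems in simp)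
  then show ?case by simp
next
  case (Conj \<phi> \<psi>)
  have "sat M u \<phi> \<longleftrightarrow> sat M v \<phi>"
    by (rule Conj.IH(1)) (use Conj.prems in simp)
  moreover have "sat M u \<psi> \<longleftrightarrow> sat M v \<psi>"
    by (rule Conj.IH(2)) (use Conj.prems in simp)
  ultimately show ?case by simp
next
  case (Disj \<phi> \<psi>)
  have "sat M u \<phi> \<longleftrightarrow> sat M v \<phi>"
    by (rule Disj.IH(1)) (use Disj.prems in simp)
  moreover have "sat M u \<psi> \<longleftrightarrow> sat M v \<psi>"
    by (rule Disj.IH(2)) (use Disj.prems in simp)
  ultimately show ?case by simp
next
  case (Ex i \<phi>)
  have "sat M (u(i := x)) \<phi> \<longleftrightarrow> sat M (v(i := x)) \<phi>" for x
    by (rule Ex.IH) (use Ex.prems in auto)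
  then show ?case by simp
qed simp_all

lemma finite_fv_tm: "finite (fv_tm t)"
  by (induction t) auto

lemma finite_fv: "finite (fv \<phi>)"
  by (induction \<phi>) (auto simp: finite_fv_tm)

lemma structure_for_closed:
  "structure_for L M \<Longrightarrow> (f, length xs) \<in> funs L \<Longrightarrow> set xs \<subseteq> univ M \<Longrightarrow> fun_int M f xs \<in> univ M"
  unfolding structure_for_def by blast

lemma val_in_univ:
  assumes "structure_for L M" "wf_tm L t" "v ` fv_tm t \<subseteq> univ M"
  shows "val M v t \<in> univ M"
  using assms(2,3)
proof (induction t)
  case (Fun f ts)
  have "val M v t \<in> univ M" if "t \<in> set ts" for t
    by (rule Fun.IH[OF that]) (use Fun.prems that in auto)
  then have "set (map (val M v) ts) \<subseteq> univ M" by auto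
  moreover have "(f, length (map (val M v) ts)) \<in> funs L" using Fun.prems(1) by simp
  ultimately show ?case using structure_for_closed[OF assms(1)] by (simp only: val.simps)
qed simp

section \<open>Ultrafilters\<close>

definition ultra :: "'i filter \<Rightarrow> bool" where
  "ultra U \<longleftrightarrow> U \<noteq> bot \<and> (\<forall>P. eventually P U \<or> eventually (\<lambda>i. \<not> P i) U)"

lemma ultra_not: "ultra U \<Longrightarrow> eventually (\<lambda>i. \<not> P i) U \<longleftrightarrow> \<not> eventually P U"
  unfolding ultra_def using eventually_conj_iff[of P "\<lambda>i. \<not> P i" U] trivial_limit_def[of U] by auto

lemma ultra_disj:
  assumes "ultra U"
  shows "eventually (\<lambda>i. P i \<or> Q i) U \<longleftrightarrow> eventually P U \<or> eventually Q U"
proof -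
  have "\<not> eventually (\<lambda>i. P i \<or> Q i) U \<longleftrightarrow> eventually (\<lambda>i. \<not> P i \<and> \<not> Q i) U"
    using ultra_not[OF assms, of "\<lambda>i. P i \<or> Q i"] by simp
  then show ?thesis unfolding eventually_conj_iff ultra_not[OF assms] by blast
qed

text \<open>Zorn's lemma for the proper filters below \<open>F\<close>, where smaller means finer. A
  minimal one decides every \<open>P\<close>: if \<open>P\<close> is not refuted, adding it keeps
  the filter proper and so changes nothing.\<close>

lemma ex_ultra_le:
  fixes F :: "'i filter"
  assumes "F \<noteq> bot"
  shows "\<exists>U \<le> F. ultra U"
proof -
  define A where "A = {G :: 'i filter. G \<noteq> bot \<and> G \<le> F}"
  define R where "R = {(G, H). G \<in> A \<and> H \<in> A \<and> H \<le> G}"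
  have Field: "Field R = A" by (auto simp: R_def Field_def)
  have "Partial_order R"
    by (auto simp: R_def Field[unfolded R_def] partial_order_on_def preorder_on_def refl_on_def
        trans_def antisym_def)
  moreover have "\<exists>U \<in> Field R. \<forall>G \<in> \<C>. (G, U) \<in> R" if \<C>: "\<C> \<in> Chains R" for \<C>
  proof (cases "\<C> = {}")
    case True
    have "F \<in> A" using assms by (simp add: A_def)
    then show ?thesis using True Field by blast
  next
    case False
    have sub: "\<C> \<subseteq> A" using \<C> by (auto simp: Chains_def R_def)
    \<comment> \<open>Along a chain, whatever holds eventually for the infimum already does so for
      one member; hence the infimum is proper.\<close>
    have "eventually P (Inf \<C>) \<longleftrightarrow> (\<exists>G \<in> \<C>. eventually P G)" for P
    proof (rule eventually_Inf_base[OF False])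
      fix G H assume "G \<in> \<C>" "H \<in> \<C>"
      then have "G \<le> H \<or> H \<le> G" using \<C> by (auto simp: Chains_def R_def)
      then show "\<exists>K \<in> \<C>. K \<le> inf G H" using \<open>G \<in> \<C>\<close> \<open>H \<in> \<C>\<close> by auto
    qed
    then have "Inf \<C> \<noteq> bot" using sub by (auto simp: A_def trivial_limit_def)
    moreover have "Inf \<C> \<le> F" using False sub by (auto simp: A_def intro: Inf_lower2)
    ultimately have "Inf \<C> \<in> A" by (simp add: A_def)
    moreover have "\<forall>G \<in> \<C>. (G, Inf \<C>) \<in> R"
      using sub \<open>Inf \<C> \<in> A\<close> by (auto simp: R_def Inf_lower)
    ultimately show ?thesis using Field by blast
  qed
  ultimately obtain U where U: "U \<in> A" and min: "\<And>G. G \<in> A \<Longrightarrow> G \<le> U \<Longrightarrow> G = U"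
    using Zorns_po_lemma[of R] unfolding Field by (auto simp: R_def)
  have "eventually P U \<or> eventually (\<lambda>i. \<not> P i) U" for P
  proof (rule disjCI)
    assume "\<not> eventually (\<lambda>i. \<not> P i) U"
    then have "inf U (principal {i. P i}) \<noteq> bot"
      by (simp add: trivial_limit_def eventually_inf_principal)
    then have "inf U (principal {i. P i}) = U"
      using U by (intro min) (auto simp: A_def le_infI1)
    moreover have "eventually P (inf U (principal {i. P i}))"
      by (simp add: eventually_inf_principal)
    ultimately show "eventually P U" by (simp only:)
  qed
  with U show ?thesis by (auto simp: A_def ultra_def)
qed

text \<open>An ultrapower of \<open>M\<close> restricted to a set \<open>G\<close> of representatives that is closed under
  Skolem functions, with universe transported along \<open>c\<close> to a prescribed type.\<close>

locale skolem_ultrapower =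
  fixes L :: "('f, 'r) signature" and M :: "('f, 'r, 'a) struct"
    and U :: "'i filter" and G :: "('i \<Rightarrow> 'a) set" and c :: "('i \<Rightarrow> 'a) \<Rightarrow> 'b"
  assumes M: "structure_for L M"
    and U: "ultra U"
    and G_nonempty: "G \<noteq> {}"
    and G_univ: "\<And>g i. g \<in> G \<Longrightarrow> g i \<in> univ M"
    and G_skolem: "\<And>\<phi> k v. wf_fm L \<phi> \<Longrightarrow> range v \<subseteq> G \<Longrightarrow>
      \<exists>g \<in> G. \<forall>i. (\<exists>x \<in> univ M. sat M ((\<lambda>j. v j i)(k := x)) \<phi>)
        \<longrightarrow> sat M ((\<lambda>j. v j i)(k := g i)) \<phi>"
    and c: "inj_on c G"
begin

definition eq :: "('i \<Rightarrow> 'a) \<Rightarrow> ('i \<Rightarrow> 'a) \<Rightarrow> bool" where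
  "eq g h \<longleftrightarrow> eventually (\<lambda>i. g i = h i) U"

text \<open>\<open>SOME\<close> sees only the predicate \<open>eq g\<close>, so equivalent functions
  receive the same representative; this stands in for a quotient.\<close>

definition rep :: "('i \<Rightarrow> 'a) \<Rightarrow> ('i \<Rightarrow> 'a)" where
  "rep g = (SOME h. h \<in> G \<and> eq g h)"

definition cls :: "('i \<Rightarrow> 'a) \<Rightarrow> 'b" where
  "cls g = c (rep g)"

definition dec :: "'b \<Rightarrow> ('i \<Rightarrow> 'a)" where
  "dec = inv_into G c"

text \<open>A pointwise value of \<open>f\<close> need not belong to \<open>G\<close>, so a member
  of \<open>G\<close> agreeing with it almost everywhere is chosen; \<open>fun_int_N\<close> shows
  that one exists.\<close>

definition N :: "('f, 'r, 'b) struct" where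
  "N = \<lparr> univ = cls ` G,
     fun_int = (\<lambda>f ds. cls (SOME g. g \<in> G \<and> eq g (\<lambda>i. fun_int M f (map (\<lambda>d. dec d i) ds)))),
     rel_int = (\<lambda>r ds. eventually (\<lambda>i. rel_int M r (map (\<lambda>d. dec d i) ds)) U) \<rparr>"

lemma eq_refl: "eq g g" and eq_sym: "eq g h \<Longrightarrow> eq h g"
  by (auto simp: eq_def eq_commute)

lemma eq_trans: "eq g h \<Longrightarrow> eq h k \<Longrightarrow> eq g k"
  unfolding eq_def by (erule (1) eventually_elim2) simp

lemma rep: assumes "g \<in> G" shows "rep g \<in> G" "eq g (rep g)"
  unfolding rep_def using someI[of "\<lambda>h. h \<in> G \<and> eq g h" g] assms eq_refl by auto

lemma rep_cong:
  assumes "eq g h" shows "rep g = rep h"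
proof -
  have "eq g = eq h" using assms eq_sym eq_trans by blast
  then show ?thesis by (simp add: rep_def)
qed

lemma dec_c: "g \<in> G \<Longrightarrow> dec (c g) = g"
  unfolding dec_def by (rule inv_into_f_f[OF c])

lemma dec_cls: assumes "g \<in> G" shows "dec (cls g) \<in> G" "eq (dec (cls g)) g"
  using rep[OF assms] eq_sym by (simp_all add: cls_def dec_c)

lemma univ_N: "univ N = cls ` G"
  by (simp add: N_def)

lemma cls_in: "g \<in> G \<Longrightarrow> cls g \<in> univ N"
  by (simp add: univ_N)

lemma dec_in: "d \<in> univ N \<Longrightarrow> dec d \<in> G"
  using dec_cls(1) by (auto simp: univ_N)

lemma cls_eq_iff: "g \<in> G \<Longrightarrow> h \<in> G \<Longrightarrow> cls g = cls h \<longleftrightarrow> eq g h"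
  using rep_cong[of g h] dec_cls(2)[of g] dec_cls(2)[of h] eq_sym eq_trans
  by (metis cls_def)

lemma dec_eq_iff:
  assumes "d \<in> univ N" "e \<in> univ N"
  shows "d = e \<longleftrightarrow> eq (dec d) (dec e)"
proof -
  obtain g h where gh: "g \<in> G" "h \<in> G" "d = cls g" "e = cls h"
    using assms by (auto simp: univ_N)
  have "eq g h \<longleftrightarrow> eq (dec (cls g)) (dec (cls h))"
    using dec_cls(2)[OF gh(1)] dec_cls(2)[OF gh(2)] eq_sym eq_trans by blast
  with gh show ?thesis by (simp add: cls_eq_iff)
qed

text \<open>The formula saying that \<open>x\<close> is the value of \<open>f\<close> has that value
  as its only witness, so closure under Skolem functions includes closure under the operations of
  \<open>L\<close>.\<close>

lemma fun_int_N:
  assumes f: "(f, length ds) \<in> funs L" and ds: "set ds \<subseteq> univ N"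
  shows "fun_int N f ds \<in> univ N"
    "eventually (\<lambda>i. dec (fun_int N f ds) i = fun_int M f (map (\<lambda>d. dec d i) ds)) U"
proof -
  define n where "n = length ds"
  define \<phi> :: "('f, 'r) fm" where "\<phi> = Eq (Var n) (Fun f (map Var [0..<n]))"
  obtain g0 where g0: "g0 \<in> G" using G_nonempty by blast
  \<comment> \<open>All values must lie in \<open>G\<close>; \<open>g0\<close> fills the variables
    that are not arguments.\<close>
  define v where "v j = (if j < n then dec (ds ! j) else g0)" for j
  have "range v \<subseteq> G"
    using g0 ds by (auto simp: v_def n_def subset_iff intro!: dec_in)
  moreover have "wf_fm L \<phi>" using f by (auto simp: \<phi>_def n_def)
  ultimately obtain g where g: "g \<in> G" "\<And>i. (\<exists>x \<in> univ M. sat M ((\<lambda>j. v j i)(n := x)) \<phi>)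
        \<longrightarrow> sat M ((\<lambda>j. v j i)(n := g i)) \<phi>"
    using G_skolem by blast
  have args: "map (val M ((\<lambda>j. v j i)(n := x))) (map Var [0..<n]) = map (\<lambda>d. dec d i) ds" for i x
    by (rule nth_equalityI) (auto simp: v_def n_def)
  have in_M: "fun_int M f (map (\<lambda>d. dec d i) ds) \<in> univ M" for i
  proof -
    have "set (map (\<lambda>d. dec d i) ds) \<subseteq> univ M"
      using ds dec_in G_univ by (auto simp: subset_iff)
    then show ?thesis using f by (intro structure_for_closed[OF M]) simp_all
  qed
  have "g i = fun_int M f (map (\<lambda>d. dec d i) ds)" for i
    using g(2)[of i] in_M[of i] by (simp add: \<phi>_def args del: map_map)
  then have "eq g (\<lambda>i. fun_int M f (map (\<lambda>d. dec d i) ds))"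
    by (simp add: eq_def)
  define h where "h = (SOME g. g \<in> G \<and> eq g (\<lambda>i. fun_int M f (map (\<lambda>d. dec d i) ds)))"
  have h: "h \<in> G" "eq h (\<lambda>i. fun_int M f (map (\<lambda>d. dec d i) ds))" "fun_int N f ds = cls h"
    unfolding h_def using someI[of "\<lambda>g. g \<in> G \<and> eq g (\<lambda>i. fun_int M f (map (\<lambda>d. dec d i) ds))" g]
      g(1) \<open>eq g _\<close> by (simp_all add: N_def)
  show "fun_int N f ds \<in> univ N" using h by (simp add: cls_in)
  show "eventually (\<lambda>i. dec (fun_int N f ds) i = fun_int M f (map (\<lambda>d. dec d i) ds)) U"
    using eq_trans[OF dec_cls(2)[OF h(1)] h(2)] h(3) by (simp add: eq_def)
qed

lemma structure_for_N: "structure_for L N"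
  unfolding structure_for_def using G_nonempty fun_int_N(1) cls_in by blast

lemma los_tm:
  assumes "wf_tm L t" "range v \<subseteq> univ N"
  shows "eventually (\<lambda>i. dec (val N v t) i = val M (\<lambda>j. dec (v j) i) t) U"
  using assms(1)
proof (induction t)
  case (Fun f ts)
  have "eventually (\<lambda>i. \<forall>t \<in> set ts. dec (val N v t) i = val M (\<lambda>j. dec (v j) i) t) U"
    using Fun by (intro eventually_ball_finite) auto
  moreover have "eventually (\<lambda>i. dec (fun_int N f (map (val N v) ts)) i
      = fun_int M f (map (\<lambda>d. dec d i) (map (val N v) ts))) U"
  proof (rule fun_int_N(2))
    show "(f, length (map (val N v) ts)) \<in> funs L" using Fun.prems by simp
    show "set (map (val N v) ts) \<subseteq> univ N"
      using Fun.prems assms(2) by (auto intro!: val_in_univ[OF structure_for_N])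
  qed
  ultimately show ?case
  proof eventually_elim
    case (elim i)
    then have "map (\<lambda>d. dec d i) (map (val N v) ts) = map (val M (\<lambda>j. dec (v j) i)) ts" by simp
    with elim(2) show ?case by (simp only: val.simps)
  qed
qed simp

text \<open>Los's theorem. Negation and disjunction use that \<open>U\<close> is ultra; for the
  quantifier, \<open>G_skolem\<close> provides one function in \<open>G\<close> that is a witness at
  every index that has one.\<close>

lemma los:
  assumes "wf_fm L \<phi>" "range v \<subseteq> univ N"
  shows "sat N v \<phi> \<longleftrightarrow> eventually (\<lambda>i. sat M (\<lambda>j. dec (v j) i) \<phi>) U"
  using assms
proof (induction \<phi> arbitrary: v)
  case (Eq s t)
  have in_N: "val N v s \<in> univ N" "val N v t \<in> univ N"
    using Eq.prems by (auto intro!: val_in_univ[OF structure_for_N])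
  have "eventually (\<lambda>i. dec (val N v s) i = val M (\<lambda>j. dec (v j) i) s
      \<and> dec (val N v t) i = val M (\<lambda>j. dec (v j) i) t) U"
    using Eq.prems by (intro eventually_conj los_tm) auto
  then have "eventually (\<lambda>i. dec (val N v s) i = dec (val N v t) i
      \<longleftrightarrow> val M (\<lambda>j. dec (v j) i) s = val M (\<lambda>j. dec (v j) i) t) U"
    by eventually_elim simp
  from eventually_subst[OF this] dec_eq_iff[OF in_N] show ?case
    by (simp add: eq_def)
next
  case (Rel r ts)
  have "eventually (\<lambda>i. \<forall>t \<in> set ts. dec (val N v t) i = val M (\<lambda>j. dec (v j) i) t) U"
    using Rel.prems by (intro eventually_ball_finite ballI los_tm) auto
  then have "eventually (\<lambda>i. rel_int M r (map (\<lambda>d. dec d i) (map (val N v) ts))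
      \<longleftrightarrow> rel_int M r (map (val M (\<lambda>j. dec (v j) i)) ts)) U"
  proof eventually_elim
    case (elim i)
    then have "map (\<lambda>d. dec d i) (map (val N v) ts) = map (val M (\<lambda>j. dec (v j) i)) ts" by simp
    then show ?case by (simp only:)
  qed
  from eventually_subst[OF this] show ?case
    by (simp add: N_def del: map_map)
next
  case Bot
  then show ?case using U by (simp add: ultra_def trivial_limit_def)
next
  case (Neg \<phi>)
  then show ?case by (simp add: ultra_not[OF U])
next
  case (Conj \<phi> \<psi>)
  then show ?case by (simp add: eventually_conj_iff)
next
  case (Disj \<phi> \<psi>)
  then show ?case by (simp add: ultra_disj[OF U])
next
  case (Ex k \<phi>)
  have upd: "(\<lambda>j. dec ((v(k := d)) j) i) = (\<lambda>j. dec (v j) i)(k := dec d i)" for d i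
    by auto
  have wf: "wf_fm L \<phi>" using Ex.prems(1) by simp
  have IH: "sat N (v(k := d)) \<phi>
      \<longleftrightarrow> eventually (\<lambda>i. sat M ((\<lambda>j. dec (v j) i)(k := dec d i)) \<phi>) U" if "d \<in> univ N" for d
  proof -
    have "range (v(k := d)) \<subseteq> univ N" using that Ex.prems(2) by auto
    from Ex.IH[OF wf this] show ?thesis unfolding upd .
  qed
  show ?case
  proof
    assume "sat N v (Ex k \<phi>)"
    then obtain d where d: "d \<in> univ N" "sat N (v(k := d)) \<phi>" by auto
    have "dec d i \<in> univ M" for i using dec_in[OF d(1)] G_univ by blast
    then show "eventually (\<lambda>i. sat M (\<lambda>j. dec (v j) i) (Ex k \<phi>)) U"
      using d(2) unfolding IH[OF d(1)] sat.simps by (auto elim!: eventually_mono)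
  next
    assume ev: "eventually (\<lambda>i. sat M (\<lambda>j. dec (v j) i) (Ex k \<phi>)) U"
    have "range (\<lambda>j. dec (v j)) \<subseteq> G" using Ex.prems(2) dec_in by blast
    from G_skolem[OF wf this, of k]
    obtain g where g: "g \<in> G" "\<And>i. (\<exists>x \<in> univ M. sat M ((\<lambda>j. dec (v j) i)(k := x)) \<phi>)
        \<Longrightarrow> sat M ((\<lambda>j. dec (v j) i)(k := g i)) \<phi>" by blast
    from ev have "eventually (\<lambda>i. sat M ((\<lambda>j. dec (v j) i)(k := g i)) \<phi>) U"
      unfolding sat.simps by (rule eventually_mono) (rule g(2))
    then have "eventually (\<lambda>i. sat M ((\<lambda>j. dec (v j) i)(k := dec (cls g) i)) \<phi>) U"
      using dec_cls(2)[OF g(1)] unfolding eq_def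
      by eventually_elim (simp only:)
    then show "sat N v (Ex k \<phi>)" using cls_in[OF g(1)] IH[OF cls_in[OF g(1)]] by auto
  qed
qed simp

lemma model_of_N:
  assumes "positive_theory L T" "model_of L T M"
  shows "model_of L T N"
proof -
  have "sat N v \<psi>" if T: "(\<phi>, \<psi>) \<in> T" and v: "range v \<subseteq> univ N" and \<phi>: "sat N v \<phi>" for \<phi> \<psi> v
  proof -
    have wf: "wf_fm L \<phi>" "wf_fm L \<psi>"
      using assms(1) T by (auto simp: positive_theory_def positive_formula_def)
    have "range (\<lambda>j. dec (v j) i) \<subseteq> univ M" for i
      using v dec_in G_univ by blast
    then have "sat M (\<lambda>j. dec (v j) i) \<psi>" if "sat M (\<lambda>j. dec (v j) i) \<phi>" for i
      using assms(2) T that unfolding model_of_def by fast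
    moreover have "eventually (\<lambda>i. sat M (\<lambda>j. dec (v j) i) \<phi>) U"
      using los[OF wf(1) v] \<phi> by simp
    ultimately show ?thesis unfolding los[OF wf(2) v] by (rule eventually_mono[rotated])
  qed
  then show ?thesis unfolding model_of_def using structure_for_N by blast
qed

end

section \<open>Maximality of positive types\<close>

definition Conjs :: "('f, 'r) fm list \<Rightarrow> ('f, 'r) fm" where
  "Conjs \<phi>s = foldr Conj \<phi>s Top"

definition Exs :: "nat list \<Rightarrow> ('f, 'r) fm \<Rightarrow> ('f, 'r) fm" where
  "Exs ks \<phi> = foldr Ex ks \<phi>"

lemma Conjs [simp]:
  "sat M v (Conjs \<phi>s) \<longleftrightarrow> (\<forall>\<phi> \<in> set \<phi>s. sat M v \<phi>)"
  "fv (Conjs \<phi>s) = \<Union> (fv ` set \<phi>s)"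
  "positive_formula L (Conjs \<phi>s) \<longleftrightarrow> (\<forall>\<phi> \<in> set \<phi>s. positive_formula L \<phi>)"
  unfolding Conjs_def by (induction \<phi>s) (auto simp: positive_formula_def)

lemma fv_Exs [simp]: "fv (Exs ks \<phi>) = fv \<phi> - set ks"
  unfolding Exs_def by (induction ks) auto

lemma positive_formula_Exs [simp]: "positive_formula L (Exs ks \<phi>) \<longleftrightarrow> positive_formula L \<phi>"
  unfolding Exs_def by (induction ks) (auto simp: positive_formula_def)

lemma sat_Exs_iff:
  "sat M v (Exs ks \<phi>) \<longleftrightarrow>
    (\<exists>v'. (\<forall>i. i \<notin> set ks \<longrightarrow> v' i = v i) \<and> (\<forall>i \<in> set ks. v' i \<in> univ M) \<and> sat M v' \<phi>)"
proof (induction ks arbitrary: v)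
  case Nil
  have "v' = v" if "\<forall>i. v' i = v i" for v' using that by blast
  then show ?case by (auto simp: Exs_def)
next
  case (Cons k ks)
  show ?case
  proof
    assume "sat M v (Exs (k # ks) \<phi>)"
    then obtain x where x: "x \<in> univ M" "sat M (v(k := x)) (Exs ks \<phi>)"
      by (auto simp: Exs_def)
    then obtain v' where v': "\<And>i. i \<notin> set ks \<Longrightarrow> v' i = (v(k := x)) i"
        "\<And>i. i \<in> set ks \<Longrightarrow> v' i \<in> univ M" "sat M v' \<phi>"
      using Cons.IH by blast
    have "v' k \<in> univ M" using v'(1)[of k] v'(2)[of k] x(1) by auto
    with v' show "\<exists>v'. (\<forall>i. i \<notin> set (k # ks) \<longrightarrow> v' i = v i)
        \<and> (\<forall>i \<in> set (k # ks). v' i \<in> univ M) \<and> sat M v' \<phi>"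
      by (intro exI[of _ v']) auto
  next
    assume "\<exists>v'. (\<forall>i. i \<notin> set (k # ks) \<longrightarrow> v' i = v i)
        \<and> (\<forall>i \<in> set (k # ks). v' i \<in> univ M) \<and> sat M v' \<phi>"
    then obtain v' where v': "\<And>i. i \<notin> set (k # ks) \<Longrightarrow> v' i = v i"
        "\<And>i. i \<in> set (k # ks) \<Longrightarrow> v' i \<in> univ M" "sat M v' \<phi>" by blast
    have "sat M (v(k := v' k)) (Exs ks \<phi>)"
      unfolding Cons.IH using v' by (intro exI[of _ v']) auto
    moreover have "v' k \<in> univ M" using v'(2) by simp
    ultimately show "sat M v (Exs (k # ks) \<phi>)" by (auto simp: Exs_def)
  qed
qed

text \<open>The listed facts and the names of the \<open>u j\<close> form a finite conjunction.
  Quantifying its elements gives a positive formula in the variables \<open>V\<close> that holds at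
  \<open>u\<close>, hence at \<open>u'\<close>. These maps are later assembled along an
  ultrafilter.\<close>

lemma ex_map_preserving_finite:
  fixes M :: "('f, 'r, 'a) struct"
  assumes M: "structure_for L M"
    and V: "finite V" "u ` V \<subseteq> univ M" "u' ` V \<subseteq> univ M"
    and uu': "\<And>\<phi>. positive_formula L \<phi> \<Longrightarrow> fv \<phi> \<subseteq> V \<Longrightarrow> sat M u \<phi> \<Longrightarrow> sat M u' \<phi>"
    and A: "finite A" "\<And>f xs. (f, xs) \<in> A \<Longrightarrow> (f, length xs) \<in> funs L \<and> set xs \<subseteq> univ M"
    and R: "finite R" "\<And>r xs. (r, xs) \<in> R \<Longrightarrow>
      (r, length xs) \<in> rels L \<and> set xs \<subseteq> univ M \<and> rel_int M r xs"
  shows "\<exists>w. w ` univ M \<subseteq> univ M \<and> (\<forall>j \<in> V. w (u j) = u' j)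
    \<and> (\<forall>(f, xs) \<in> A. w (fun_int M f xs) = fun_int M f (map w xs))
    \<and> (\<forall>(r, xs) \<in> R. rel_int M r (map w xs))"
proof -
  define E where "E = u ` V \<union> (\<Union>(f, xs) \<in> A. insert (fun_int M f xs) (set xs)) \<union> (\<Union>(r, xs) \<in> R. set xs)"
  have E_fin: "finite E" using V A(1) R(1) by (auto simp: E_def)
  have E_u: "u j \<in> E" if "j \<in> V" for j using that by (auto simp: E_def)
  have E_A: "fun_int M f xs \<in> E" "set xs \<subseteq> E" if "(f, xs) \<in> A" for f xs
    using that by (auto simp: E_def)
  have E_R: "set xs \<subseteq> E" if "(r, xs) \<in> R" for r xs
    using that by (auto simp: E_def)
  \<comment> \<open>Bound variables start at \<open>m\<close>, beyond the free variables in
    \<open>V\<close>, to avoid clashes.\<close>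
  obtain m where m: "V \<subseteq> {..<m}" using V(1) unfolding finite_nat_set_iff_bounded by blast
  obtain idx where idx: "bij_betw idx E {0..<card E}" using ex_bij_betw_finite_nat[OF E_fin] by blast
  define pos where "pos x = m + idx x" for x
  have pos_inj: "inj_on pos E" using idx by (auto simp: pos_def bij_betw_def inj_on_def)
  have pos_range: "pos x \<in> {m..<m + card E}" if "x \<in> E" for x
    using idx that by (auto simp: pos_def bij_betw_def)
  \<comment> \<open>The elements of \<open>E\<close> are named by the variables \<open>ks\<close>, bound in the formula \<open>\<chi>\<close> below; a witness
    of \<open>\<chi>\<close> at \<open>u'\<close> is the required map.\<close>
  define ks where "ks = [m..<m + card E]"
  define fA :: "'f \<Rightarrow> 'a list \<Rightarrow> ('f, 'r) fm" where
    "fA f xs = Eq (Fun f (map (Var \<circ> pos) xs)) (Var (pos (fun_int M f xs)))" for f xs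
  define fR :: "'r \<Rightarrow> 'a list \<Rightarrow> ('f, 'r) fm" where
    "fR r xs = Rel r (map (Var \<circ> pos) xs)" for r xs
  define fV :: "nat \<Rightarrow> ('f, 'r) fm" where "fV j = Eq (Var j) (Var (pos (u j)))" for j
  have "finite (case_prod fA ` A \<union> case_prod fR ` R \<union> fV ` V)" using A(1) R(1) V(1) by simp
  from finite_list[OF this] obtain \<phi>s where
    \<phi>s: "set \<phi>s = case_prod fA ` A \<union> case_prod fR ` R \<union> fV ` V" ..
  have ball_\<phi>s: "(\<forall>\<phi> \<in> set \<phi>s. P \<phi>) \<longleftrightarrow> (\<forall>(f, xs) \<in> A. P (fA f xs))
      \<and> (\<forall>(r, xs) \<in> R. P (fR r xs)) \<and> (\<forall>j \<in> V. P (fV j))" for P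
    unfolding \<phi>s by (auto split: prod.splits)
  define \<chi> where "\<chi> = Exs ks (Conjs \<phi>s)"
  have "positive_formula L (fA f xs)" if "(f, xs) \<in> A" for f xs
    using A(2)[OF that] by (simp add: fA_def positive_formula_def)
  moreover have "positive_formula L (fR r xs)" if "(r, xs) \<in> R" for r xs
    using R(2)[OF that] by (simp add: fR_def positive_formula_def)
  moreover have "positive_formula L (fV j)" for j
    by (simp add: fV_def positive_formula_def)
  ultimately have "positive_formula L \<chi>"
    unfolding \<chi>_def positive_formula_Exs Conjs ball_\<phi>s by blast
  moreover have "fv \<chi> \<subseteq> V"
  proof -
    have pos: "pos ` X \<subseteq> set ks" if "X \<subseteq> E" for X
      using that pos_range by (auto simp: ks_def)
    have "fv (fA f xs) \<subseteq> V \<union> set ks" if "(f, xs) \<in> A" for f xs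
    proof -
      have "fv (fA f xs) = pos ` insert (fun_int M f xs) (set xs)" by (auto simp: fA_def)
      moreover have "pos ` insert (fun_int M f xs) (set xs) \<subseteq> set ks"
        using E_A[OF that] by (intro pos) simp
      ultimately show ?thesis by (simp only: le_supI2)
    qed
    moreover have "fv (fR r xs) \<subseteq> V \<union> set ks" if "(r, xs) \<in> R" for r xs
    proof -
      have "fv (fR r xs) = pos ` set xs" by (auto simp: fR_def)
      then show ?thesis using pos[OF E_R[OF that]] by (simp only: le_supI2)
    qed
    moreover have "fv (fV j) \<subseteq> V \<union> set ks" if "j \<in> V" for j
    proof -
      have "fv (fV j) = {j, pos (u j)}" by (auto simp: fV_def)
      then show ?thesis using pos[of "{u j}"] E_u[OF that] that by simp
    qed
    ultimately have "\<forall>\<phi> \<in> set \<phi>s. fv \<phi> \<subseteq> V \<union> set ks" unfolding ball_\<phi>s by blast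
    then show ?thesis unfolding \<chi>_def fv_Exs Conjs by auto
  qed
  moreover have "sat M u \<chi>"
  proof -
    \<comment> \<open>At \<open>u\<close> each bound variable takes the element of \<open>E\<close>
      that it names; the default value only has to lie in the universe.\<close>
    define v where "v k = (if k \<in> set ks then (if k \<in> pos ` E then inv_into E pos k else (SOME x. x \<in> univ M)) else u k)" for k
    have v_pos: "v (pos x) = x" if "x \<in> E" for x
      using that pos_range[OF that] pos_inj by (simp add: v_def ks_def)
    have v_V: "v j = u j" if "j \<in> V" for j
      using that m by (auto simp: v_def ks_def)
    have map_pos: "map (val M v) (map (Var \<circ> pos) xs) = xs" if "set xs \<subseteq> E" for xs
      using that v_pos by (simp add: map_idI subset_iff)
    have E_univ: "E \<subseteq> univ M"
    proof -
      have "insert (fun_int M f xs) (set xs) \<subseteq> univ M" if "(f, xs) \<in> A" for f xs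
        using A(2)[OF that] structure_for_closed[OF M] by blast
      moreover have "set xs \<subseteq> univ M" if "(r, xs) \<in> R" for r xs
        using R(2)[OF that] by blast
      ultimately show ?thesis using V(2) unfolding E_def by blast
    qed
    have "univ M \<noteq> {}" using M by (simp add: structure_for_def)
    then have "(SOME x. x \<in> univ M) \<in> univ M" by (simp add: some_in_eq)
    then have "v k \<in> univ M" if "k \<in> set ks" for k
      using that E_univ inv_into_into[of k pos E] by (auto simp: v_def)
    moreover have "sat M v (fA f xs)" if "(f, xs) \<in> A" for f xs
      using map_pos[OF E_A(2)[OF that]] v_pos[OF E_A(1)[OF that]] by (simp add: fA_def del: map_map)
    moreover have "sat M v (fR r xs)" if "(r, xs) \<in> R" for r xs
      using map_pos[OF E_R[OF that]] R(2)[OF that] by (simp add: fR_def del: map_map)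
    moreover have "sat M v (fV j)" if "j \<in> V" for j
      using v_V[OF that] v_pos[OF E_u[OF that]] by (simp add: fV_def)
    ultimately have "(\<forall>i \<in> set ks. v i \<in> univ M) \<and> sat M v (Conjs \<phi>s)"
      unfolding Conjs ball_\<phi>s by blast
    moreover have "\<forall>i. i \<notin> set ks \<longrightarrow> v i = u i" by (simp add: v_def)
    ultimately show ?thesis unfolding \<chi>_def sat_Exs_iff by blast
  qed
  ultimately have "sat M u' \<chi>" by (rule uu')
  then obtain v where v: "\<And>i. i \<notin> set ks \<Longrightarrow> v i = u' i" "\<And>i. i \<in> set ks \<Longrightarrow> v i \<in> univ M"
      and v_sat: "sat M v (Conjs \<phi>s)"
    unfolding \<chi>_def sat_Exs_iff by blast
  define w where "w x = (if x \<in> E then v (pos x) else x)" for x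
  have map_w: "map (val M v) (map (Var \<circ> pos) xs) = map w xs" if "set xs \<subseteq> E" for xs
    using that by (auto simp: w_def)
  have "w x \<in> univ M" if "x \<in> univ M" for x
    using that v(2)[of "pos x"] pos_range[of x] by (simp add: w_def ks_def)
  then have "w ` univ M \<subseteq> univ M" by blast
  moreover have "w (u j) = u' j" if "j \<in> V" for j
  proof -
    have "sat M v (fV j)" using v_sat that unfolding Conjs ball_\<phi>s by blast
    moreover have "v j = u' j" using that m by (intro v(1)) (auto simp: ks_def)
    ultimately show ?thesis using E_u[OF that] by (simp add: fV_def w_def)
  qed
  moreover have "w (fun_int M f xs) = fun_int M f (map w xs)" if "(f, xs) \<in> A" for f xs
  proof -
    have "sat M v (fA f xs)" using v_sat that unfolding Conjs ball_\<phi>s by blast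
    then have "fun_int M f (map w xs) = v (pos (fun_int M f xs))"
      using map_w[OF E_A(2)[OF that]] by (simp add: fA_def del: map_map)
    then show ?thesis using E_A(1)[OF that] by (simp add: w_def)
  qed
  moreover have "rel_int M r (map w xs)" if "(r, xs) \<in> R" for r xs
  proof -
    have "sat M v (fR r xs)" using v_sat that unfolding Conjs ball_\<phi>s by blast
    then show ?thesis using map_w[OF E_R[OF that]] by (simp add: fR_def del: map_map)
  qed
  ultimately show ?thesis by blast
qed

text \<open>This is the type over which \<open>existentially_closed\<close> lets the target models
  range; the hull has to fit into it.\<close>

lemma card_of_UNIV_summands:
  "|A :: 'a set| \<le>o |UNIV :: ('a + 'f + 'r + nat) set|"
  "|B :: 'f set| \<le>o |UNIV :: ('a + 'f + 'r + nat) set|"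
  "|D :: 'r set| \<le>o |UNIV :: ('a + 'f + 'r + nat) set|"
proof -
  have "inj_on (Inl :: _ \<Rightarrow> 'a + 'f + 'r + nat) A" "inj_on (Inr \<circ> Inl :: _ \<Rightarrow> 'a + 'f + 'r + nat) B"
    "inj_on (Inr \<circ> Inr \<circ> Inl :: _ \<Rightarrow> 'a + 'f + 'r + nat) D"
    by (auto simp: inj_on_def)
  then show "|A| \<le>o |UNIV :: ('a + 'f + 'r + nat) set|"
    "|B| \<le>o |UNIV :: ('a + 'f + 'r + nat) set|" "|D| \<le>o |UNIV :: ('a + 'f + 'r + nat) set|"
    by (meson card_of_ordLeqI UNIV_I)+
qed

text \<open>For each finite set \<open>i\<close> of atomic facts there is a map \<open>w i\<close>
  that preserves them and sends \<open>u\<close> to \<open>u'\<close>. Each fact is preserved for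
  almost all \<open>i\<close>, so sending \<open>m\<close> to the class of
  \<open>\<lambda>i. w i m\<close> is a homomorphism; \<open>\<phi>\<close> holds at the image of
  \<open>u\<close> by \<open>los\<close> and is reflected.\<close>

lemma existentially_closed_type_maximal:
  fixes L :: "('f, 'r) signature" and M :: "('f, 'r, 'a) struct"
  assumes T: "positive_theory L T" and ec: "existentially_closed L T M"
    and \<phi>: "positive_formula L \<phi>"
    and u: "u ` fv \<phi> \<subseteq> univ M" "u' ` fv \<phi> \<subseteq> univ M"
    and uu': "\<And>\<psi>. positive_formula L \<psi> \<Longrightarrow> fv \<psi> \<subseteq> fv \<phi> \<Longrightarrow> sat M u \<psi> \<Longrightarrow> sat M u' \<psi>"
    and sat: "sat M u' \<phi>"
  shows "sat M u \<phi>"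
proof -
  have model: "model_of L T M" using ec by (simp add: existentially_closed_def)
  then have M: "structure_for L M" by (simp add: model_of_def)
  then obtain m0 where m0: "m0 \<in> univ M" by (auto simp: structure_for_def)
  define \<Delta> :: "(('f \<times> 'a list) + ('r \<times> 'a list)) set" where
    "\<Delta> = Inl ` {(f, xs). (f, length xs) \<in> funs L \<and> set xs \<subseteq> univ M}
      \<union> Inr ` {(r, xs). (r, length xs) \<in> rels L \<and> set xs \<subseteq> univ M \<and> rel_int M r xs}"
  define Q where "Q i w \<longleftrightarrow> (\<forall>j \<in> fv \<phi>. w (u j) = u' j)
    \<and> (\<forall>(f, xs) \<in> Inl -` i. w (fun_int M f xs) = fun_int M f (map w xs))
    \<and> (\<forall>(r, xs) \<in> Inr -` i. rel_int M r (map w xs))"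
    for i :: "(('f \<times> 'a list) + ('r \<times> 'a list)) set" and w
  \<comment> \<open>Indices that are not finite subsets of \<open>\<Delta>\<close> are negligible
    for \<open>U\<close>; there \<open>id\<close> serves as a map of \<open>univ M\<close> into
    itself.\<close>
  have ex_w: "\<exists>w. w ` univ M \<subseteq> univ M \<and> (finite i \<and> i \<subseteq> \<Delta> \<longrightarrow> Q i w)" for i
  proof (cases "finite i \<and> i \<subseteq> \<Delta>")
    case True
    have "\<exists>w. w ` univ M \<subseteq> univ M \<and> Q i w"
      unfolding Q_def
    proof (rule ex_map_preserving_finite[OF M finite_fv u uu'])
      show "finite (Inl -` i)" "finite (Inr -` i)" using True by (auto intro: finite_vimageI)
      show "(f, length xs) \<in> funs L \<and> set xs \<subseteq> univ M" if "(f, xs) \<in> Inl -` i" for f xs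
        using that True by (auto simp: \<Delta>_def)
      show "(r, length xs) \<in> rels L \<and> set xs \<subseteq> univ M \<and> rel_int M r xs"
        if "(r, xs) \<in> Inr -` i" for r xs
        using that True by (auto simp: \<Delta>_def)
    qed
    then show ?thesis by blast
  next
    case False
    then show ?thesis by (intro exI[of _ id]) auto
  qed
  define w where "w i = (SOME w. w ` univ M \<subseteq> univ M \<and> (finite i \<and> i \<subseteq> \<Delta> \<longrightarrow> Q i w))" for i
  have w: "w i ` univ M \<subseteq> univ M \<and> (finite i \<and> i \<subseteq> \<Delta> \<longrightarrow> Q i (w i))" for i
    unfolding w_def by (rule someI_ex[OF ex_w])
  have w_u: "w i (u j) = u' j" if "finite i" "i \<subseteq> \<Delta>" "j \<in> fv \<phi>" for i j
    using w[of i] that by (simp add: Q_def)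
  have w_fun: "w i (fun_int M f xs) = fun_int M f (map (w i) xs)"
    if "finite i" "i \<subseteq> \<Delta>" "Inl (f, xs) \<in> i" for i f xs
    using w[of i] that by (auto simp: Q_def)
  have w_rel: "rel_int M r (map (w i) xs)"
    if "finite i" "i \<subseteq> \<Delta>" "Inr (r, xs) \<in> i" for i r xs
    using w[of i] that by (auto simp: Q_def)
  \<comment> \<open>For each fact, the finite sets containing it are eventual in this filter, hence
    also for \<open>U\<close>.\<close>
  obtain U where U_le: "U \<le> finite_subsets_at_top \<Delta>" and U: "ultra U"
    using ex_ultra_le[OF finite_subsets_at_top_neq_bot] by blast
  have ev: "eventually (\<lambda>i. finite i \<and> i \<subseteq> \<Delta> \<and> x \<in> i) U" if "x \<in> \<Delta>" for x
    by (rule filter_leD[OF U_le])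
      (use that in \<open>auto simp: eventually_finite_subsets_at_top intro!: exI[of _ "{x}"]\<close>)
  have ev': "eventually (\<lambda>i. finite i \<and> i \<subseteq> \<Delta>) U"
    by (rule filter_leD[OF U_le]) auto
  \<comment> \<open>The default \<open>m0\<close> keeps the Skolem functions in
    \<open>univ M\<close> when no witness exists.\<close>
  define skol where "skol \<psi> k ys = (if \<exists>x \<in> univ M. sat M ((nth ys)(k := x)) \<psi>
    then SOME x. x \<in> univ M \<and> sat M ((nth ys)(k := x)) \<psi> else m0)" for \<psi> :: "('f, 'r) fm" and k ys
  have skol: "skol \<psi> k ys \<in> univ M \<and>
      ((\<exists>x \<in> univ M. sat M ((nth ys)(k := x)) \<psi>) \<longrightarrow> sat M ((nth ys)(k := skol \<psi> k ys)) \<psi>)" for \<psi> k ys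
    using someI_ex[of "\<lambda>x. x \<in> univ M \<and> sat M ((nth ys)(k := x)) \<psi>"] m0
    unfolding skol_def by (simp add: Bex_def)
  \<comment> \<open>These functions represent the images of the elements of \<open>M\<close>, so the
    homomorphism takes its values in the hull.\<close>
  define S where "S = (\<lambda>m i. w i m) ` univ M"
  define I where "I = {\<psi>. wf_fm L \<psi>} \<times> (UNIV :: nat set)"
  define F where "F = (\<lambda>(\<psi>, k) gs (i :: (('f \<times> 'a list) + ('r \<times> 'a list)) set).
    skol \<psi> k (map (\<lambda>g. g i) gs))"
  define G where "G = hull S I F"
  \<comment> \<open>The size of this type bounds \<open>univ M\<close>, the set of formulas and thus
    the hull, which yields the coding \<open>c\<close>.\<close>
  let ?X = "UNIV :: ('a + 'f + 'r + nat) set"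
  have X: "infinite ?X" by (simp add: finite_Plus_UNIV_iff)
  have "|funs L| \<le>o |?X|"
    by (rule ordLeq_transitive[OF card_of_mono1[of _ "UNIV \<times> UNIV"]])
      (simp, intro card_of_Times_ordLeq X card_of_UNIV_summands card_of_nat_ordLeq)
  moreover have "|rels L| \<le>o |?X|"
    by (rule ordLeq_transitive[OF card_of_mono1[of _ "UNIV \<times> UNIV"]])
      (simp, intro card_of_Times_ordLeq X card_of_UNIV_summands card_of_nat_ordLeq)
  ultimately have "|G| \<le>o |?X|"
    unfolding G_def S_def I_def
    by (intro card_of_hull_ordLeq card_of_image_ordLeq card_of_Times_ordLeq card_of_wf_fm
        card_of_UNIV_summands(1) card_of_nat_ordLeq X)
  then obtain c :: "_ \<Rightarrow> 'a + 'f + 'r + nat" where c: "inj_on c G"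
    unfolding card_of_ordLeq[symmetric] by blast
  interpret skolem_ultrapower L M U G c
  proof
    show "G \<noteq> {}" using m0 by (auto simp: G_def S_def intro: hull_base)
    show "g i \<in> univ M" if "g \<in> G" for g i
      using that unfolding G_def
    proof induction
      case (hull_base g)
      then show ?case using w by (auto simp: S_def)
    next
      case (hull_step ik gs)
      then show ?case using skol by (auto simp: F_def split: prod.splits)
    qed
    show "\<exists>g \<in> G. \<forall>i. (\<exists>x \<in> univ M. sat M ((\<lambda>j. v j i)(k := x)) \<psi>)
        \<longrightarrow> sat M ((\<lambda>j. v j i)(k := g i)) \<psi>" if wf: "wf_fm L \<psi>" and v: "range v \<subseteq> G" for \<psi> k v
    proof -
      \<comment> \<open>Only finitely many variables matter, so a finite list \<open>gs\<close> of
        arguments determines the Skolem value.\<close>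
      obtain n where n: "fv \<psi> \<subseteq> {..<n}" using finite_fv[of \<psi>] unfolding finite_nat_set_iff_bounded by blast
      define gs where "gs = map v [0..<n]"
      have "v j \<in> G" for j using v by blast
      then have "gs \<in> lists G" by (auto simp: gs_def)
      then have "F (\<psi>, k) gs \<in> G"
        unfolding G_def by (intro hull_step) (use wf in \<open>simp add: I_def\<close>)
      moreover have "sat M ((\<lambda>j. v j i)(k := x)) \<psi> \<longleftrightarrow> sat M ((nth (map (\<lambda>g. g i) gs))(k := x)) \<psi>" for i x
        by (rule sat_cong) (use n in \<open>auto simp: gs_def\<close>)
      then have "\<forall>i. (\<exists>x \<in> univ M. sat M ((\<lambda>j. v j i)(k := x)) \<psi>)
        \<longrightarrow> sat M ((\<lambda>j. v j i)(k := F (\<psi>, k) gs i)) \<psi>"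
        using skol by (simp add: F_def)
      ultimately show ?thesis by blast
    qed
  qed (fact M U c)+
  define h where "h m = cls (\<lambda>i. w i m)" for m
  have in_G: "(\<lambda>i. w i m) \<in> G" if "m \<in> univ M" for m
    using that by (auto simp: G_def S_def intro: hull_base)
  have dec_h: "eventually (\<lambda>i. dec (h m) i = w i m) U" if "m \<in> univ M" for m
    using dec_cls(2)[OF in_G[OF that]] by (simp add: h_def eq_def)
  have h_univ: "h m \<in> univ N" if "m \<in> univ M" for m
    unfolding h_def by (rule cls_in[OF in_G[OF that]])
  have ev_map: "eventually (\<lambda>i. map (\<lambda>d. dec d i) (map h xs) = map (w i) xs) U"
    if "set xs \<subseteq> univ M" for xs
  proof -
    have "eventually (\<lambda>i. \<forall>x \<in> set xs. dec (h x) i = w i x) U"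
      using that dec_h by (intro eventually_ball_finite) auto
    then show ?thesis by eventually_elim simp
  qed
  have "homomorphism L M N h"
  proof -
    have "h (fun_int M f xs) = fun_int N f (map h xs)"
      if f: "(f, length xs) \<in> funs L" and xs: "set xs \<subseteq> univ M" for f xs
    proof -
      have in_M: "fun_int M f xs \<in> univ M" using structure_for_closed[OF M f xs] .
      have "set (map h xs) \<subseteq> univ N" using xs h_univ by auto
      moreover have "(f, length (map h xs)) \<in> funs L" using f by simp
      ultimately have N: "fun_int N f (map h xs) \<in> univ N" "eventually (\<lambda>i. dec (fun_int N f (map h xs)) i
          = fun_int M f (map (\<lambda>d. dec d i) (map h xs))) U"
        by (blast intro: fun_int_N)+
      have "Inl (f, xs) \<in> \<Delta>" using f xs by (auto simp: \<Delta>_def)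
      from ev[OF this] N(2) ev_map[OF xs] dec_h[OF in_M]
      have "eventually (\<lambda>i. dec (h (fun_int M f xs)) i = dec (fun_int N f (map h xs)) i) U"
        by eventually_elim (simp only: w_fun)
      then show ?thesis using dec_eq_iff[OF h_univ[OF in_M] N(1)] by (simp add: eq_def)
    qed
    moreover have "rel_int N r (map h xs)"
      if "(r, length xs) \<in> rels L" and xs: "set xs \<subseteq> univ M" and "rel_int M r xs" for r xs
    proof -
      have "Inr (r, xs) \<in> \<Delta>" using that by (auto simp: \<Delta>_def)
      from ev[OF this] ev_map[OF xs]
      have "eventually (\<lambda>i. rel_int M r (map (\<lambda>d. dec d i) (map h xs))) U"
        by eventually_elim (simp only: w_rel)
      then show ?thesis unfolding N_def by simp
    qed
    ultimately show ?thesis unfolding homomorphism_def using h_univ by fast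
  qed
  moreover have "model_of L T N" by (rule model_of_N[OF T model])
  \<comment> \<open>\<open>existentially_closed\<close> concerns valuations with all values in
    \<open>univ M\<close>, so \<open>u\<close> is corrected outside
    \<open>fv \<phi>\<close>.\<close>
  moreover define v where "v j = (if j \<in> fv \<phi> then u j else m0)" for j
  have v: "range v \<subseteq> univ M" using u(1) m0 by (auto simp: v_def)
  moreover have "sat N (h \<circ> v) \<phi>"
  proof -
    have "range (h \<circ> v) \<subseteq> univ N" using v h_univ by auto
    moreover have "wf_fm L \<phi>" using \<phi> by (simp add: positive_formula_def)
    moreover have "eventually (\<lambda>i. sat M (\<lambda>j. dec ((h \<circ> v) j) i) \<phi>) U"
    proof -
      have "eventually (\<lambda>i. \<forall>j \<in> fv \<phi>. dec (h (v j)) i = w i (v j)) U"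
        using v dec_h finite_fv by (intro eventually_ball_finite) auto
      with ev' show ?thesis
      proof eventually_elim
        case (elim i)
        then have "dec ((h \<circ> v) j) i = u' j" if "j \<in> fv \<phi>" for j
          using that w_u by (simp add: v_def)
        then have "sat M (\<lambda>j. dec ((h \<circ> v) j) i) \<phi> \<longleftrightarrow> sat M u' \<phi>" by (rule sat_cong)
        with sat show ?case by simp
      qed
    qed
    ultimately show ?thesis using los by blast
  qed
  ultimately have "sat M v \<phi>"
    using ec \<phi> unfolding existentially_closed_def by blast
  moreover have "sat M v \<phi> \<longleftrightarrow> sat M u \<phi>" by (rule sat_cong) (simp add: v_def)
  ultimately show ?thesis by simp
qed

section \<open>Realising the limit type\<close>

primrec rename_tm :: "(nat \<Rightarrow> nat) \<Rightarrow> 'f tm \<Rightarrow> 'f tm" where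
  "rename_tm \<pi> (Var i) = Var (\<pi> i)"
| "rename_tm \<pi> (Fun f ts) = Fun f (map (rename_tm \<pi>) ts)"

primrec rename :: "(nat \<Rightarrow> nat) \<Rightarrow> ('f, 'r) fm \<Rightarrow> ('f, 'r) fm" where
  "rename \<pi> (Eq s t) = Eq (rename_tm \<pi> s) (rename_tm \<pi> t)"
| "rename \<pi> (Rel r ts) = Rel r (map (rename_tm \<pi>) ts)"
| "rename \<pi> Top = Top"
| "rename \<pi> Bot = Bot"
| "rename \<pi> (Neg \<phi>) = Neg (rename \<pi> \<phi>)"
| "rename \<pi> (Conj \<phi> \<psi>) = Conj (rename \<pi> \<phi>) (rename \<pi> \<psi>)"
| "rename \<pi> (Disj \<phi> \<psi>) = Disj (rename \<pi> \<phi>) (rename \<pi> \<psi>)"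
| "rename \<pi> (Ex i \<phi>) = Ex (\<pi> i) (rename \<pi> \<phi>)"

lemma val_rename_tm: "val M v (rename_tm \<pi> t) = val M (v \<circ> \<pi>) t"
proof (induction t)
  case (Fun f ts)
  then have "map (val M v) (map (rename_tm \<pi>) ts) = map (val M (v \<circ> \<pi>)) ts" by (simp add: o_def)
  then show ?case by (simp only: val.simps rename_tm.simps)
qed simp

text \<open>Bound variables are renamed too; injectivity ensures that changing the value at
  \<open>\<pi> i\<close> affects only variable \<open>i\<close>, so nothing is captured.\<close>

lemma sat_rename:
  assumes "inj \<pi>"
  shows "sat M v (rename \<pi> \<phi>) \<longleftrightarrow> sat M (v \<circ> \<pi>) \<phi>"
proof (induction \<phi> arbitrary: v)
  case (Rel r ts)
  have "map (val M v) (map (rename_tm \<pi>) ts) = map (val M (v \<circ> \<pi>)) ts" by (simp add: val_rename_tm)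
  then show ?case by (simp only: sat.simps rename.simps)
next
  case (Ex i \<phi>)
  have "v(\<pi> i := x) \<circ> \<pi> = (v \<circ> \<pi>)(i := x)" for x
    using assms by (auto simp: inj_def)
  then show ?case unfolding rename.simps sat.simps Ex.IH by (simp only:)
qed (simp_all add: val_rename_tm)

lemma wf_rename_tm: "wf_tm L (rename_tm \<pi> t) \<longleftrightarrow> wf_tm L t"
  by (induction t) auto

lemma positive_formula_rename: "positive_formula L (rename \<pi> \<phi>) \<longleftrightarrow> positive_formula L \<phi>"
  by (induction \<phi>) (auto simp: positive_formula_def wf_rename_tm)

lemma sat_param_cong:
  assumes "\<And>i. i \<in> fv \<phi> \<Longrightarrow> p i = q i" "\<And>i. i \<in> fv \<phi> - dom p \<Longrightarrow> u i = v i"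
  shows "sat_param M u (\<phi>, p) \<longleftrightarrow> sat_param M v (\<phi>, q)"
  unfolding sat_param_def prod.case
proof (rule sat_cong)
  fix i assume "i \<in> fv \<phi>"
  then show "(case p i of None \<Rightarrow> u i | Some c \<Rightarrow> c) = (case q i of None \<Rightarrow> v i | Some c \<Rightarrow> c)"
    using assms(1)[of i] assms(2)[of i] by (cases "p i") (auto simp: domIff split: option.splits)
qed

lemma same_type_sym: "same_type L M C xs ys \<Longrightarrow> same_type L M C ys xs"
  by (auto simp: same_type_def)

lemma same_type_trans: "same_type L M C xs ys \<Longrightarrow> same_type L M C ys zs \<Longrightarrow> same_type L M C xs zs"
  unfolding same_type_def by (auto split: prod.splits)

text \<open>By maximality of types one inclusion suffices. Parameters become values of free
  variables, so maximality applies to the tuple together with the parameters of the formula.\<close>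

lemma same_typeI:
  assumes T: "positive_theory L T" and ec: "existentially_closed L T M" and C: "C \<subseteq> univ M"
    and len: "length xs = length ys" and xs: "set xs \<subseteq> univ M" and ys: "set ys \<subseteq> univ M"
    and pres: "\<And>\<phi> p. (\<phi>, p) \<in> formulas_over L C \<Longrightarrow> fv \<phi> - dom p \<subseteq> {..<length xs} \<Longrightarrow>
      sat_param M (nth xs) (\<phi>, p) \<Longrightarrow> sat_param M (nth ys) (\<phi>, p)"
  shows "same_type L M C xs ys"
proof -
  have "sat_param M (nth xs) (\<phi>, p)" if over: "(\<phi>, p) \<in> formulas_over L C"
    and fv: "fv \<phi> - dom p \<subseteq> {..<length xs}" and sat: "sat_param M (nth ys) (\<phi>, p)" for \<phi> p
  proof -
    define ev where "ev zs i = (case p i of None \<Rightarrow> zs ! i | Some c \<Rightarrow> c)" for zs i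
    have p: "ran p \<subseteq> C" and \<phi>: "positive_formula L \<phi>" using over by (auto simp: formulas_over_def)
    have ev_univ: "ev zs ` fv \<phi> \<subseteq> univ M" if zs: "set zs \<subseteq> univ M" "length zs = length xs" for zs
    proof (rule image_subsetI)
      fix i assume i: "i \<in> fv \<phi>"
      show "ev zs i \<in> univ M"
      proof (cases "p i")
        case None
        with i fv have "i < length zs" using zs(2) by auto
        with zs(1) None show ?thesis by (auto simp: ev_def)
      next
        case (Some c)
        then have "c \<in> ran p" by (rule ranI)
        with p C Some show ?thesis by (auto simp: ev_def)
      qed
    qed
    have ev: "sat_param M (nth zs) (\<psi>, p) \<longleftrightarrow> sat M (ev zs) \<psi>" for zs \<psi>
      by (simp add: sat_param_def ev_def[abs_def])
    have "sat M (ev xs) \<phi>"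
    proof (rule existentially_closed_type_maximal[OF T ec \<phi>])
      show "ev xs ` fv \<phi> \<subseteq> univ M" "ev ys ` fv \<phi> \<subseteq> univ M"
        using ev_univ xs ys len by simp_all
      show "sat M (ev ys) \<phi>" using sat ev by simp
      show "sat M (ev ys) \<psi>" if "positive_formula L \<psi>" "fv \<psi> \<subseteq> fv \<phi>" "sat M (ev xs) \<psi>" for \<psi>
        using pres[of \<psi> p] that p fv ev by (auto simp: formulas_over_def)
    qed
    then show ?thesis by (simp add: ev)
  qed
  then show ?thesis unfolding same_type_def using len pres by blast
qed

text \<open>A finite parameter map is coded by an association list; arbitrary maps from the
  variables to \<open>C\<close> could be too many.\<close>

lemma card_of_finite_param_formulas:
  assumes X: "infinite X" and "|funs L| \<le>o |X|" "|rels L| \<le>o |X|" "|C| \<le>o |X|"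
  shows "|{(\<phi>, p) \<in> formulas_over L C. finite (dom p)}| \<le>o |X|"
proof -
  have "{(\<phi>, p) \<in> formulas_over L C. finite (dom p)}
      \<subseteq> (\<lambda>(\<phi>, xs). (\<phi>, map_of xs)) ` ({\<phi>. wf_fm L \<phi>} \<times> lists ((UNIV :: nat set) \<times> C))"
  proof clarify
    fix \<phi> p assume p: "(\<phi>, p) \<in> formulas_over L C" "finite (dom p)"
    define xs where "xs = map (\<lambda>i. (i, the (p i))) (sorted_list_of_set (dom p))"
    have "map_of xs = p"
      unfolding xs_def map_of_map_restrict using p(2)
      by (auto simp: restrict_map_def domIff fun_eq_iff)
    moreover have "c \<in> C" if "p i = Some c" for i c
      using ranI[of p i c, OF that] p(1) by (auto simp: formulas_over_def)
    then have "xs \<in> lists ((UNIV :: nat set) \<times> C)" using p(2) by (auto simp: xs_def)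
    moreover have "wf_fm L \<phi>" using p(1) by (simp add: formulas_over_def positive_formula_def)
    ultimately show "(\<phi>, p) \<in> (\<lambda>(\<phi>, xs). (\<phi>, map_of xs)) ` ({\<phi>. wf_fm L \<phi>} \<times> lists ((UNIV :: nat set) \<times> C))"
      by (intro image_eqI[of _ _ "(\<phi>, xs)"]) auto
  qed
  moreover have "|(\<lambda>(\<phi>, xs). (\<phi>, map_of xs)) ` ({\<phi>. wf_fm L \<phi>} \<times> lists ((UNIV :: nat set) \<times> C))| \<le>o |X|"
    by (intro card_of_image_ordLeq card_of_Times_ordLeq card_of_lists_ordLeq card_of_wf_fm
        card_of_nat_ordLeq assms)
  ultimately show ?thesis by (rule ordLeq_transitive[OF card_of_mono1])
qed

lemma small_finite_param_formulas:
  assumes \<kappa>: "Card_order \<kappa>" "small \<kappa> (UNIV :: nat set)"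
    and "small \<kappa> (funs L)" "small \<kappa> (rels L)" "small \<kappa> C"
  shows "small \<kappa> {(\<phi>, p) \<in> formulas_over L C. finite (dom p)}"
proof -
  \<comment> \<open>One infinite set dominating all ingredients; as a finite sum of sets below the
    infinite cardinal \<open>\<kappa>\<close> it stays below \<open>\<kappa>\<close>.\<close>
  define X where "X = (funs L <+> rels L) <+> (C <+> (UNIV :: nat set))"
  have "infinite (Field \<kappa>)"
    using \<kappa> ordLess_imp_ordLeq ordLeq_ordIso_trans[OF _ ordIso_symmetric[OF card_of_Field_ordIso[OF \<kappa>(1)]]]
    unfolding infinite_iff_card_of_nat by blast
  then have "|X| <o \<kappa>"
    unfolding X_def by (intro card_of_Plus_ordLess_infinite_Field \<kappa> assms)
  moreover have "infinite X" by (simp add: X_def)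
  moreover have "|funs L| \<le>o |X|" "|rels L| \<le>o |X|" "|C| \<le>o |X|"
    unfolding X_def
    by (rule ordLeq_transitive[OF _ card_of_Plus1], rule card_of_Plus1)
      (rule ordLeq_transitive[OF _ card_of_Plus1], rule card_of_Plus2,
        rule ordLeq_transitive[OF card_of_Plus1 card_of_Plus2])
  ultimately show ?thesis
    using card_of_finite_param_formulas ordLeq_ordLess_trans by blast
qed

text \<open>One \<open>n\<close> bounds lengths and entries alike, and an entry \<open>x < n\<close>
  satisfies \<open>x + 2 \<le> n + 1\<close>.\<close>

lemma finite_in_bounded_tree:
  assumes "finite S"
  shows "\<exists>n. S \<subseteq> bounded_tree (n + 1) n"
proof -
  have "finite (length ` S \<union> \<Union> (set ` S))" using assms by simp
  then obtain n where n: "\<And>x. x \<in> length ` S \<union> \<Union> (set ` S) \<Longrightarrow> x < n"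
    unfolding finite_nat_set_iff_bounded by blast
  have "S \<subseteq> bounded_tree (n + 1) n"
  proof
    fix \<eta> assume "\<eta> \<in> S"
    then have "length \<eta> < n" "\<And>x. x \<in> set \<eta> \<Longrightarrow> x < n" using n by blast+
    then show "\<eta> \<in> bounded_tree (n + 1) n" by (auto simp: bounded_tree_def Suc_le_eq)
  qed
  then show ?thesis ..
qed

lemma bounded_tree_mono: "n \<le> m \<Longrightarrow> bounded_tree (n + 1) n \<subseteq> bounded_tree (m + 1) m"
  by (fastforce simp: bounded_tree_def)

lemma tree_equiv_refl: "tree_equiv S \<eta>s \<eta>s"
  by (simp add: tree_equiv_def)

theorem theorem4p10:
  fixes L :: "('f, 'r) signature"
    and T :: "('f, 'r) positive_theory"
    and \<kappa> :: "'k rel"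
    and M :: "('f, 'r, 'a) struct"
    and C :: "'a set"
    and a :: "nat list \<Rightarrow> 'a"
  assumes "positive_theory L T"
    and "monster_model L T \<kappa> M"
    and "C \<subseteq> univ M" and "small \<kappa> C"
    and "range a \<subseteq> univ M"
    and "tree_indiscernible L_str L M C a"
  shows "\<exists>b :: nat list \<Rightarrow> 'a. range b \<subseteq> univ M \<and>
    tree_indiscernible L_str0 L M C b \<and> tree_based L_str0 L M C b a"
proof -
  have ec: "existentially_closed L T M" and sat: "very_saturated L \<kappa> M"
    and \<kappa>: "Card_order \<kappa>" "small \<kappa> (UNIV :: nat set)" "small \<kappa> (funs L)" "small \<kappa> (rels L)"
    using assms(2) by (simp_all add: monster_model_def)
  define h where "h n = lex_level (n + 1) n" for n
  \<comment> \<open>With \<open>n = m\<close> this is indiscernibility at one stage; with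
    \<open>\<eta>s = \<nu>s\<close> it says that the type does not change between stages.\<close>
  have a_same: "same_type L M C (map (a \<circ> h n) \<eta>s) (map (a \<circ> h m) \<nu>s)"
    if "set \<eta>s \<subseteq> bounded_tree (n + 1) n" "set \<nu>s \<subseteq> bounded_tree (m + 1) m"
      "tree_equiv L_str0 \<eta>s \<nu>s" for n m \<eta>s \<nu>s
  proof -
    have "tree_equiv L_str (map (h n) \<eta>s) (map (h m) \<nu>s)"
      unfolding h_def by (rule tree_equiv_lex_level) (use that in auto)
    then have "same_type L M C (map a (map (h n) \<eta>s)) (map a (map (h m) \<nu>s))"
      using assms(6) unfolding tree_indiscernible_def by blast
    then show ?thesis by simp
  qed
  \<comment> \<open>Every sequence \<open>\<eta>\<close> is named by all variables \<open>to_nat (j, \<eta>)\<close>, so that tuples with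
    repetitions can also be substituted by an injective renaming, which captures no variables.\<close>
  define node where "node k = snd (from_nat k :: nat \<times> nat list)" for k
  have node: "node (to_nat (j, \<eta>)) = \<eta>" for j :: nat and \<eta> :: "nat list"
    by (simp add: node_def)
  define asg where "asg n k = a (h n (node k))" for n k
  \<comment> \<open>The limit type consists of the formulas true at all late stages, so any finite
    part is realised by some \<open>asg n\<close>. Finiteness of \<open>dom p\<close> keeps it
    small.\<close>
  define \<Sigma> where "\<Sigma> = {(\<phi>, p) \<in> formulas_over L C. finite (dom p)
    \<and> eventually (\<lambda>n. sat_param M (asg n) (\<phi>, p)) sequentially}"
  have "\<exists>v. range v \<subseteq> univ M \<and> (\<forall>\<sigma> \<in> \<Sigma>. sat_param M v \<sigma>)"
  proof -
    have "\<Sigma> \<subseteq> formulas_over L (univ M)"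
      using assms(3) by (auto simp: \<Sigma>_def formulas_over_def)
    moreover have "small \<kappa> \<Sigma>"
    proof -
      have "\<Sigma> \<subseteq> {(\<phi>, p) \<in> formulas_over L C. finite (dom p)}" by (auto simp: \<Sigma>_def)
      from ordLeq_ordLess_trans[OF card_of_mono1[OF this]] show ?thesis
        using small_finite_param_formulas[OF \<kappa> assms(4)] by blast
    qed
    moreover have "\<exists>v. range v \<subseteq> univ M \<and> (\<forall>\<sigma> \<in> F. sat_param M v \<sigma>)" if F: "finite F \<and> F \<subseteq> \<Sigma>" for F
    proof -
      have "eventually (\<lambda>n. sat_param M (asg n) \<sigma>) sequentially" if "\<sigma> \<in> F" for \<sigma>
        using that F by (auto simp: \<Sigma>_def)
      then have "eventually (\<lambda>n. \<forall>\<sigma> \<in> F. sat_param M (asg n) \<sigma>) sequentially"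
        using F by (intro eventually_ball_finite) auto
      then obtain n where "\<forall>\<sigma> \<in> F. sat_param M (asg n) \<sigma>"
        unfolding eventually_sequentially by blast
      moreover have "range (asg n) \<subseteq> univ M" using assms(5) by (auto simp: asg_def)
      ultimately show ?thesis by blast
    qed
    ultimately show ?thesis using sat unfolding very_saturated_def by blast
  qed
  then obtain v where v: "range v \<subseteq> univ M" and v_sat: "\<And>\<sigma>. \<sigma> \<in> \<Sigma> \<Longrightarrow> sat_param M v \<sigma>" by blast
  define b where "b \<eta> = v (to_nat (0 :: nat, \<eta>))" for \<eta> :: "nat list"
  have b: "range b \<subseteq> univ M" using v by (auto simp: b_def)
  \<comment> \<open>All variables naming \<open>\<eta>\<close> agree under every
    \<open>asg n\<close>, so these equations belong to \<open>\<Sigma>\<close>.\<close>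
  have v_b: "v (to_nat (j, \<eta>)) = b \<eta>" for j :: nat and \<eta> :: "nat list"
  proof -
    have "(Eq (Var (to_nat (j, \<eta>))) (Var (to_nat (0 :: nat, \<eta>))), Map.empty) \<in> \<Sigma>"
      by (simp add: \<Sigma>_def formulas_over_def positive_formula_def sat_param_def asg_def node)
    from v_sat[OF this] show ?thesis by (simp add: sat_param_def b_def)
  qed
  \<comment> \<open>A formula true of the tuple at stage \<open>n\<close> stays true at later stages
    by \<open>a_same\<close>; after renaming it lies in \<open>\<Sigma>\<close> and so holds of
    \<open>b\<close>. The converse comes from \<open>same_typeI\<close>.\<close>
  have b_same: "same_type L M C (map (a \<circ> h n) \<eta>s) (map b \<eta>s)"
    if \<eta>s: "set \<eta>s \<subseteq> bounded_tree (n + 1) n" for n \<eta>s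
  proof (rule same_typeI[OF assms(1) ec assms(3)])
    show "set (map (a \<circ> h n) \<eta>s) \<subseteq> univ M" "set (map b \<eta>s) \<subseteq> univ M"
      using assms(5) b by auto
    fix \<phi> p
    assume over: "(\<phi>, p) \<in> formulas_over L C"
      and fv: "fv \<phi> - dom p \<subseteq> {..<length (map (a \<circ> h n) \<eta>s)}"
      and holds: "sat_param M (nth (map (a \<circ> h n) \<eta>s)) (\<phi>, p)"
    \<comment> \<open>The index \<open>j\<close> in the pair keeps \<open>\<pi>\<close> injective
      when \<open>\<eta>s\<close> has repetitions; \<open>[]\<close> is a filler beyond its
      length.\<close>
    define \<pi> where "\<pi> j = to_nat (j, if j < length \<eta>s then \<eta>s ! j else [])" for j
    have \<pi>: "inj \<pi>" by (auto simp: inj_def \<pi>_def)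
    \<comment> \<open>The parameters follow their variables; restricting to renamed free variables
      makes the domain finite even when \<open>dom p\<close> is infinite.\<close>
    define q where "q k = (if k \<in> \<pi> ` fv \<phi> then p (inv \<pi> k) else None)" for k
    have dom_q: "dom q \<subseteq> \<pi> ` fv \<phi>" by (auto simp: q_def split: if_splits)
    have ran_q: "ran q \<subseteq> ran p" by (auto simp: q_def ran_def split: if_splits)
    have q: "sat_param M w (rename \<pi> \<phi>, q) \<longleftrightarrow> sat_param M (nth (map d \<eta>s)) (\<phi>, p)"
      if "\<And>j. j < length \<eta>s \<Longrightarrow> w (\<pi> j) = d (\<eta>s ! j)" for w d
    proof -
      have "sat_param M w (rename \<pi> \<phi>, q) \<longleftrightarrow> sat_param M (w \<circ> \<pi>) (\<phi>, q \<circ> \<pi>)"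
        by (simp add: sat_param_def sat_rename[OF \<pi>] comp_def)
      also have "\<dots> \<longleftrightarrow> sat_param M (nth (map d \<eta>s)) (\<phi>, p)"
      proof (rule sat_param_cong)
        show eq: "(q \<circ> \<pi>) i = p i" if "i \<in> fv \<phi>" for i
          using that \<pi> by (simp add: q_def)
        show "(w \<circ> \<pi>) i = map d \<eta>s ! i" if "i \<in> fv \<phi> - dom (q \<circ> \<pi>)" for i
        proof -
          have "i \<in> fv \<phi> - dom p" using that eq by (auto simp: domIff)
          then have "i < length \<eta>s" using fv by auto
          then show ?thesis using \<open>\<And>j. j < length \<eta>s \<Longrightarrow> w (\<pi> j) = d (\<eta>s ! j)\<close> by simp
        qed
      qed
      finally show ?thesis .
    qed
    have "sat_param M (asg m) (rename \<pi> \<phi>, q)" if "n \<le> m" for m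
    proof -
      have "set \<eta>s \<subseteq> bounded_tree (m + 1) m" using \<eta>s bounded_tree_mono[OF that] by blast
      from a_same[OF \<eta>s this tree_equiv_refl] over fv holds
      have "sat_param M (nth (map (a \<circ> h m) \<eta>s)) (\<phi>, p)"
        unfolding same_type_def by blast
      moreover have "asg m (\<pi> j) = (a \<circ> h m) (\<eta>s ! j)" if "j < length \<eta>s" for j
        using that by (simp add: asg_def \<pi>_def node)
      ultimately show ?thesis using q by blast
    qed
    then have "eventually (\<lambda>m. sat_param M (asg m) (rename \<pi> \<phi>, q)) sequentially"
      unfolding eventually_sequentially by blast
    moreover have "finite (dom q)" using dom_q finite_fv finite_subset by blast
    moreover have "(rename \<pi> \<phi>, q) \<in> formulas_over L C"
      using over ran_q by (auto simp: formulas_over_def positive_formula_rename)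
    ultimately have "sat_param M v (rename \<pi> \<phi>, q)" by (intro v_sat) (simp add: \<Sigma>_def)
    moreover have "v (\<pi> j) = b (\<eta>s ! j)" if "j < length \<eta>s" for j
      using that by (simp add: \<pi>_def v_b)
    ultimately show "sat_param M (nth (map b \<eta>s)) (\<phi>, p)" using q by blast
  qed simp
  have "tree_indiscernible L_str0 L M C b"
    unfolding tree_indiscernible_def
  proof (intro allI impI)
    fix \<eta>s \<nu>s assume eq: "tree_equiv L_str0 \<eta>s \<nu>s"
    obtain n where "set \<eta>s \<union> set \<nu>s \<subseteq> bounded_tree (n + 1) n"
      using finite_in_bounded_tree[of "set \<eta>s \<union> set \<nu>s"] by auto
    then have \<eta>s: "set \<eta>s \<subseteq> bounded_tree (n + 1) n" and \<nu>s: "set \<nu>s \<subseteq> bounded_tree (n + 1) n" by auto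
    show "same_type L M C (map b \<eta>s) (map b \<nu>s)"
      by (rule same_type_trans[OF same_type_sym[OF b_same[OF \<eta>s]]
            same_type_trans[OF a_same[OF \<eta>s \<nu>s eq] b_same[OF \<nu>s]]])
  qed
  moreover have "tree_based L_str0 L M C b a"
    unfolding tree_based_def
  proof
    fix \<eta>s
    obtain n where n: "set \<eta>s \<subseteq> bounded_tree (n + 1) n"
      using finite_in_bounded_tree[of "set \<eta>s"] by auto
    have "tree_equiv L_str0 (map (h n) \<eta>s) \<eta>s"
      unfolding h_def by (rule tree_equiv_str0_lex_level[OF _ n]) simp
    moreover have "same_type L M C (map b \<eta>s) (map a (map (h n) \<eta>s))"
      using same_type_sym[OF b_same[OF n]] by simp
    ultimately show "\<exists>\<nu>s. tree_equiv L_str0 \<nu>s \<eta>s \<and> same_type L M C (map b \<eta>s) (map a \<nu>s)" by blast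
  qed
  ultimately show ?thesis using b by blast
qed

end
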